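(* Let $n=2^e\ge 4$, $m=n/2=2^{e-1}$, let $k,l\in\{0,1\}$ with $k=l=0$ if $e=2$, let $G=G_2(e;k,l)$ with defining generators $a,b$, and let $z=a^mb^m$. Then the following hold. (i) The elements $a^m$, $b^m$ and $z=a^mb^m$ are central involutions of $G$. (ii) For all integers $i,j$, $$b^ja^i=\begin{cases} a^ib^j & \text{if } i \text{ and } j \text{ are even},\\ a^ib^{-j}z^{lj/2} & \text{if } i \text{ is odd and } j \text{ is even},\\ a^{-i}b^{j}z^{li/2} & \text{if } i \text{ is even and } j \text{ is odd},\\ a^{-i}b^{-j}z^{k+l(i+j)/2} & \text{if } i \text{ and } j \text{ are odd}.\end{cases}$$ (iii) For all integers $i,j$, the element $g=a^ib^j$ has order: dividing $m$ if $i$ and $j$ are even; equal to $n$, with $g^m=a^m$, if $i$ is odd and $j$ is even; equal to $n$, with $g^m=b^m$, if $i$ is even and $j$ is odd; dividing $4$, and equal to $2$ if $k=l=0$, if $i$ and $j$ are odd. (iv) $G$ is isobicyclic, that is, $G=\langle a\rangle\langle b\rangle$ where $|a|=|b|=2^e$ and $\langle a\rangle\cap\langle b\rangle=1$, and there is an involutory automorphism of $G$ interchanging $a$ and $b$. (v) $G'=\langle a^2b^{-2}z^k\rangle\times\langle a^4z^l\rangle$ with $\langle a^2b^{-2}z^k\rangle\cong C_m$ and $\langle a^4z^l\rangle\cong C_{m/2}$. (vi) $G$ is not metacyclic. (vii) $G$ has nilpotence class $e$, with upper central series $1=Z_0<Z_1<\cdots<Z_e=G$ where $Z_i=\langle a^{2^{e-i}}\rangle\langle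 b^{2^{e-i}}\rangle$ for $i=0,1,\dots,e$.
   Context: Conventions: $x^y=y^{-1}xy$ and $[x,y]=x^{-1}y^{-1}xy$; $G'$ is the derived subgroup and $C_r$ is the cyclic group of order $r$. A group is metacyclic if it has a cyclic normal subgroup with cyclic quotient. For $n=2^e\ge 4$ and $k,l\in\{0,1\}$ (with $k=l=0$ when $n=4$), $$G_2(e;k,l)=\langle a,b\mid a^n=b^n=[b^2,a^2]=1,\ [b,a]=a^2b^{-2}(a^{n/2}b^{n/2})^k,\ (b^2)^a=b^{-2}(a^{n/2}b^{n/2})^l,\ (a^2)^b=a^{-2}(a^{n/2}b^{n/2})^l\rangle .$$ *)

theory Defs
  imports "HOL-Algebra.Algebra"
begin

section \<open>Free groups and groups given by generators and relations\<close>

text \<open>A letter \<open>(x, s)\<close> stands for the generator \<open>x\<close> if \<open>s = False\<close> and for its formal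
  inverse if \<open>s = True\<close>. Elements of the free group are the freely reduced words.\<close>

type_synonym 'g word = "('g \<times> bool) list"

definition flip :: "'g \<times> bool \<Rightarrow> 'g \<times> bool" where
  "flip x = (fst x, \<not> snd x)"

fun reduced :: "'g word \<Rightarrow> bool" where
  "reduced [] \<longleftrightarrow> True"
| "reduced [x] \<longleftrightarrow> True"
| "reduced (x # y # w) \<longleftrightarrow> y \<noteq> flip x \<and> reduced (y # w)"

fun lmult :: "'g \<times> bool \<Rightarrow> 'g word \<Rightarrow> 'g word" where
  "lmult x [] = [x]"
| "lmult x (y # w) = (if y = flip x then w else x # y # w)"

definition free_group :: "'g word monoid" where
  "free_group = \<lparr>carrier = {w. reduced w}, monoid.mult = foldr lmult, one = []\<rparr>"

definition free_gen :: "'g \<Rightarrow> 'g word" where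
  "free_gen x = [(x, False)]"

definition normal_closure :: "('a, 'b) monoid_scheme \<Rightarrow> 'a set \<Rightarrow> 'a set" where
  "normal_closure G S = \<Inter>{N. N \<lhd> G \<and> S \<subseteq> N}"

text \<open>A pair \<open>(u, v)\<close> of free group elements stands for the relation \<open>u = v\<close>.\<close>

definition relator_closure :: "('g word \<times> 'g word) set \<Rightarrow> 'g word set" where
  "relator_closure R =
     normal_closure free_group ((\<lambda>(u, v). u \<otimes>\<^bsub>free_group\<^esub> inv\<^bsub>free_group\<^esub> v) ` R)"

definition presented_group :: "('g word \<times> 'g word) set \<Rightarrow> 'g word set monoid" where
  "presented_group R = free_group Mod relator_closure R"

definition presented_gen :: "('g word \<times> 'g word) set \<Rightarrow> 'g \<Rightarrow> 'g word set" where
  "presented_gen R x = relator_closure R #>\<^bsub>free_group\<^esub> free_gen x"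

lemma flip_flip [simp]: "flip (flip x) = x"
  by (simp add: flip_def)

lemma flip_neq [simp]: "flip x \<noteq> x"
  by (cases x) (simp add: flip_def)

lemma reduced_ConsD: "reduced (x # w) \<Longrightarrow> reduced w"
  by (cases w) auto

lemma reduced_lmult: "reduced w \<Longrightarrow> reduced (lmult x w)"
  by (cases w) (auto dest: reduced_ConsD)

lemma lmult_reduced: "reduced (x # w) \<Longrightarrow> lmult x w = x # w"
  by (cases w) auto

lemma lmult_flip: "reduced w \<Longrightarrow> lmult x (lmult (flip x) w) = w"
  by (cases w) (auto simp: lmult_reduced)

lemma reduced_foldr_lmult: "reduced v \<Longrightarrow> reduced (foldr lmult u v)"
  by (induction u) (auto intro: reduced_lmult)

lemma foldr_lmult_lmult:
  assumes "reduced v" "reduced w"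
  shows "foldr lmult (lmult x v) w = lmult x (foldr lmult v w)"
proof (cases v)
  case (Cons y v')
  then show ?thesis
    using assms lmult_flip[of "foldr lmult v' w" x] by (auto simp: reduced_foldr_lmult)
qed simp

lemma foldr_lmult_assoc:
  assumes "reduced v" "reduced w"
  shows "foldr lmult (foldr lmult u v) w = foldr lmult u (foldr lmult v w)"
  using assms by (induction u) (auto simp: foldr_lmult_lmult reduced_foldr_lmult)

lemma foldr_lmult_inverse:
  "reduced w \<Longrightarrow> \<exists>v. reduced v \<and> foldr lmult v w = []"
proof (induction w)
  case (Cons x w)
  then obtain v where v: "reduced v" "foldr lmult v w = []"
    using reduced_ConsD by blast
  have "foldr lmult (foldr lmult v [flip x]) (x # w) = foldr lmult v (foldr lmult [flip x] (x # w))"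
    using Cons.prems by (intro foldr_lmult_assoc) auto
  also have "\<dots> = []"
    using v by simp
  finally show ?case
    using reduced_foldr_lmult[of "[flip x]" v] by auto
qed (auto intro: exI[of _ "[]"])

lemma group_free_group: "group free_group"
  by (rule groupI)
     (auto simp: free_group_def reduced_foldr_lmult foldr_lmult_assoc foldr_lmult_inverse)

lemma free_gen_closed: "free_gen x \<in> carrier free_group"
  by (simp add: free_gen_def free_group_def)

lemma (in group) normal_normal_closure:
  assumes "S \<subseteq> carrier G"
  shows "normal_closure G S \<lhd> G"
proof -
  have c: "carrier G \<lhd> G"
    by (auto simp: normal_inv_iff subgroup_self)
  show ?thesis
    unfolding normal_closure_def
  proof (rule normal_invI)
    show "subgroup (\<Inter>{N. N \<lhd> G \<and> S \<subseteq> N}) G"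
      using c assms by (intro subgroups_Inter) (auto simp: normal_imp_subgroup)
  qed (auto simp: normal_inv_iff)
qed

lemma group_presented_group:
  assumes "\<And>u v. (u, v) \<in> R \<Longrightarrow> u \<in> carrier free_group \<and> v \<in> carrier free_group"
  shows "group (presented_group R)"
proof -
  interpret group free_group by (rule group_free_group)
  have "relator_closure R \<lhd> free_group"
    unfolding relator_closure_def using assms by (intro normal_normal_closure) auto
  then show ?thesis
    unfolding presented_group_def by (rule normal.factorgroup_is_group)
qed

section \<open>The groups \<open>G\<^sub>2(e; k, l)\<close>\<close>

definition conj_by :: "('a, 'b) monoid_scheme \<Rightarrow> 'a \<Rightarrow> 'a \<Rightarrow> 'a" where
  "conj_by G x y = inv\<^bsub>G\<^esub> y \<otimes>\<^bsub>G\<^esub> x \<otimes>\<^bsub>G\<^esub> y"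

definition commutator :: "('a, 'b) monoid_scheme \<Rightarrow> 'a \<Rightarrow> 'a \<Rightarrow> 'a" where
  "commutator G x y = inv\<^bsub>G\<^esub> x \<otimes>\<^bsub>G\<^esub> inv\<^bsub>G\<^esub> y \<otimes>\<^bsub>G\<^esub> x \<otimes>\<^bsub>G\<^esub> y"

datatype gen2 = GenA | GenB

definition G2_rels :: "nat \<Rightarrow> nat \<Rightarrow> nat \<Rightarrow> (gen2 word \<times> gen2 word) set" where
  "G2_rels e k l =
    (let F = free_group; a = free_gen GenA; b = free_gen GenB; n = (2::nat) ^ e;
         z = a [^]\<^bsub>F\<^esub> (n div 2) \<otimes>\<^bsub>F\<^esub> b [^]\<^bsub>F\<^esub> (n div 2)
     in {(a [^]\<^bsub>F\<^esub> n, \<one>\<^bsub>F\<^esub>),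
         (b [^]\<^bsub>F\<^esub> n, \<one>\<^bsub>F\<^esub>),
         (commutator F (b [^]\<^bsub>F\<^esub> (2::nat)) (a [^]\<^bsub>F\<^esub> (2::nat)), \<one>\<^bsub>F\<^esub>),
         (commutator F b a, a [^]\<^bsub>F\<^esub> (2::int) \<otimes>\<^bsub>F\<^esub> b [^]\<^bsub>F\<^esub> (-2::int) \<otimes>\<^bsub>F\<^esub> z [^]\<^bsub>F\<^esub> k),
         (conj_by F (b [^]\<^bsub>F\<^esub> (2::nat)) a, b [^]\<^bsub>F\<^esub> (-2::int) \<otimes>\<^bsub>F\<^esub> z [^]\<^bsub>F\<^esub> l),
         (conj_by F (a [^]\<^bsub>F\<^esub> (2::nat)) b, a [^]\<^bsub>F\<^esub> (-2::int) \<otimes>\<^bsub>F\<^esub> z [^]\<^bsub>F\<^esub> l)})"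

definition G2 :: "nat \<Rightarrow> nat \<Rightarrow> nat \<Rightarrow> gen2 word set monoid" where
  "G2 e k l = presented_group (G2_rels e k l)"

definition G2_a :: "nat \<Rightarrow> nat \<Rightarrow> nat \<Rightarrow> gen2 word set" where
  "G2_a e k l = presented_gen (G2_rels e k l) GenA"

definition G2_b :: "nat \<Rightarrow> nat \<Rightarrow> nat \<Rightarrow> gen2 word set" where
  "G2_b e k l = presented_gen (G2_rels e k l) GenB"

lemma group_G2: "group (G2 e k l)"
proof -
  interpret group "free_group :: gen2 word monoid" by (rule group_free_group)
  show ?thesis
    unfolding G2_def
    by (rule group_presented_group)
       (auto simp: G2_rels_def Let_def commutator_def conj_by_def free_gen_closed)
qed

section \<open>Group-theoretic notions\<close>

definition group_center :: "('a, 'b) monoid_scheme \<Rightarrow> 'a set" where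
  "group_center G = {x \<in> carrier G. \<forall>y \<in> carrier G. x \<otimes>\<^bsub>G\<^esub> y = y \<otimes>\<^bsub>G\<^esub> x}"

text \<open>\<open>Z\<^bsub>i+1\<^esub>/Z\<^sub>i\<close> is the centre of \<open>G/Z\<^sub>i\<close>.\<close>

primrec upper_central :: "('a, 'b) monoid_scheme \<Rightarrow> nat \<Rightarrow> 'a set" where
  "upper_central G 0 = {\<one>\<^bsub>G\<^esub>}"
| "upper_central G (Suc i) =
     {x \<in> carrier G. upper_central G i #>\<^bsub>G\<^esub> x \<in> group_center (G Mod upper_central G i)}"

definition has_nilpotence_class :: "('a, 'b) monoid_scheme \<Rightarrow> nat \<Rightarrow> bool" where
  "has_nilpotence_class G c \<longleftrightarrow>
     upper_central G c = carrier G \<and> (\<forall>d<c. upper_central G d \<noteq> carrier G)"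

definition metacyclic :: "('a, 'b) monoid_scheme \<Rightarrow> bool" where
  "metacyclic G \<longleftrightarrow>
     (\<exists>N. N \<lhd> G \<and> cyclic_group (subgroup_generated G N) \<and> cyclic_group (G Mod N))"

definition internal_direct_product ::
    "('a, 'b) monoid_scheme \<Rightarrow> 'a set \<Rightarrow> 'a set \<Rightarrow> 'a set \<Rightarrow> bool" where
  "internal_direct_product G D H K \<longleftrightarrow>
     subgroup H G \<and> subgroup K G \<and> D = H <#>\<^bsub>G\<^esub> K \<and> H \<inter> K = {\<one>\<^bsub>G\<^esub>} \<and>
     (\<forall>h \<in> H. \<forall>k \<in> K. h \<otimes>\<^bsub>G\<^esub> k = k \<otimes>\<^bsub>G\<^esub> h)"

text \<open>Composition in \<^const>\<open>AutoGroup\<close> is that of maps restricted to the carrier, so an involutory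
  automorphism is exactly an element of order 2 there.\<close>

definition isobicyclic :: "('a, 'b) monoid_scheme \<Rightarrow> nat \<Rightarrow> 'a \<Rightarrow> 'a \<Rightarrow> bool" where
  "isobicyclic G n a b \<longleftrightarrow>
     a \<in> carrier G \<and> b \<in> carrier G \<and>
     carrier G = generate G {a} <#>\<^bsub>G\<^esub> generate G {b} \<and>
     group.ord G a = n \<and> group.ord G b = n \<and>
     generate G {a} \<inter> generate G {b} = {\<one>\<^bsub>G\<^esub>} \<and>
     (\<exists>\<phi> \<in> carrier (AutoGroup G). group.ord (AutoGroup G) \<phi> = 2 \<and> \<phi> a = b \<and> \<phi> b = a)"

end

theory Submission
  imports Defs
begin

text \<open>Put \<open>h = n/4\<close>. The relations alone yield the commutation formulas (ii), so every element has a
  normal form \<open>a\<^sup>i b\<^sup>j\<close>. Conversely, these formulas say how left multiplication by \<open>a\<close> and \<open>b\<close> ought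
  to act on the exponent pairs \<open>(i, j)\<close> modulo \<open>n\<close>; the two resulting permutations satisfy the relations,
  and looking at the orbit of \<open>(0, 0)\<close> shows that the exponents in a normal form are unique modulo \<open>n\<close>.
  All remaining claims become congruences between exponents. The relations are symmetric in \<open>a\<close> and
  \<open>b\<close>, which gives the automorphism in (iv).\<close>

section \<open>Consequences of the relations\<close>

text \<open>The relations alone bound the order only from above: collection turns every word into
  some \<open>a^i b^j\<close>, but nothing yet excludes collapse. A product defined directly on
  exponent pairs would require an associativity proof for a formula with four parity cases. For
  permutations associativity is free, and only the defining relations remain to be checked. The
  model keeps integer pairs: it uses permutations respecting congruence modulo \<open>4 * h\<close>,
  and divides out those that move every pair within its class, so no canonical residues are needed.

  The unit \<open>h\<close> suits the element \<open>z\<close>, which adds \<open>2 * h\<close> to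
  both exponents, while exponents count modulo \<open>4 * h\<close>. The restriction k = l = 0 for n
  = 4 says precisely that \<open>k * h\<close> and \<open>l * h\<close> are even. This parity makes
  \<open>z\<close> central, makes the action of \<open>b\<close> compatible with the modulus, and
  removes the error terms \<open>2 * h * (l * h)\<close> that arise whenever a relation is raised to
  the power \<open>h\<close>.\<close>

lemma (in group) mult_inv_cancel [simp]:
  assumes "x \<in> carrier G" "y \<in> carrier G"
  shows "x \<otimes> (inv x \<otimes> y) = y" "inv x \<otimes> (x \<otimes> y) = y"
  using assms by (simp_all flip: m_assoc)

lemma (in group) conj_int_pow:
  fixes i :: int
  assumes "x \<in> carrier G" "g \<in> carrier G"
  shows "(inv g \<otimes> x \<otimes> g) [^] i = inv g \<otimes> x [^] i \<otimes> g"
proof -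
  have "(\<lambda>x. inv g \<otimes> x \<otimes> g) \<in> hom G G"
    using assms by (auto intro!: homI simp: m_assoc)
  then have "group_hom G G (\<lambda>x. inv g \<otimes> x \<otimes> g)"
    by (simp add: group_hom_def group_hom_axioms_def is_group)
  from group_hom.hom_int_pow[OF this assms(1), of i] show ?thesis
    by simp
qed

lemma (in group) int_pow_commute_left:
  fixes i :: int
  assumes "x \<otimes> y = y \<otimes> x" "x \<in> carrier G" "y \<in> carrier G"
  shows "x [^] i \<otimes> y = y \<otimes> x [^] i"
proof -
  have "inv y \<otimes> x [^] i \<otimes> y = (inv y \<otimes> x \<otimes> y) [^] i"
    using assms by (simp add: conj_int_pow)
  also have "inv y \<otimes> x \<otimes> y = x"
    using assms by (simp add: m_assoc inv_solve_left inv_solve_left')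
  finally show ?thesis
    using assms by (simp add: m_assoc inv_solve_left inv_solve_left')
qed

lemma (in group) int_pow_commute:
  fixes i j :: int
  assumes "x \<otimes> y = y \<otimes> x" "x \<in> carrier G" "y \<in> carrier G"
  shows "x [^] i \<otimes> y [^] j = y [^] j \<otimes> x [^] i"
  using assms by (metis int_pow_commute_left int_pow_closed)

lemma (in group) int_pow_conj_rule:
  fixes t :: int
  assumes c: "x \<in> carrier G" "y \<in> carrier G" "g \<in> carrier G"
    and eq: "x \<otimes> g = g \<otimes> y"
  shows "x [^] t \<otimes> g = g \<otimes> y [^] t"
proof -
  have y: "y = inv g \<otimes> x \<otimes> g"
    using c eq by (simp add: m_assoc inv_solve_left inv_solve_left')
  show ?thesis
    unfolding y using c by (subst conj_int_pow) (simp_all add: m_assoc inv_solve_left inv_solve_left')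
qed

text \<open>The relations appear as rewriting rules \<open>x y = y x w\<close> or
  \<open>x y = y w\<close> with integer exponents. \<open>z\<close> is a parameter tied down by an
  equation, so that exchanging \<open>a\<close> and \<open>b\<close> can keep the same
  \<open>z\<close>.\<close>

locale G2_relations = group G for G (structure) +
  fixes h k l :: int and a b z
  assumes h_pos: "h > 0"
    and k: "k \<in> {0, 1}" and l: "l \<in> {0, 1}" and odd_h: "odd h \<Longrightarrow> k = 0 \<and> l = 0"
    and a_closed [simp, intro]: "a \<in> carrier G" and b_closed [simp, intro]: "b \<in> carrier G"
    and z_def: "z = a [^] (2 * h) \<otimes> b [^] (2 * h)"
    and rel_a: "a [^] (4 * h) = \<one>" and rel_b: "b [^] (4 * h) = \<one>"
    and rel_sq: "b [^] (2::int) \<otimes> a [^] (2::int) = a [^] (2::int) \<otimes> b [^] (2::int)"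
    and rel_ba: "b \<otimes> a = a \<otimes> b \<otimes> (a [^] (2::int) \<otimes> b [^] (- 2::int) \<otimes> z [^] k)"
    and rel_b2a: "b [^] (2::int) \<otimes> a = a \<otimes> (b [^] (- 2::int) \<otimes> z [^] l)"
    and rel_a2b: "a [^] (2::int) \<otimes> b = b \<otimes> (a [^] (- 2::int) \<otimes> z [^] l)"
begin

lemma z_closed [simp, intro]: "z \<in> carrier G"
  by (simp add: z_def)

lemma even_lh: "even (l * h)" and even_kh: "even (k * h)"
  using odd_h by auto

lemma even_commute:
  assumes "even i" "even j"
  shows "b [^] (j::int) \<otimes> a [^] (i::int) = a [^] i \<otimes> b [^] j"
proof -
  obtain s t where "i = 2 * s" "j = 2 * t"
    using assms by (auto elim!: evenE)
  then show ?thesis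
    using int_pow_commute[OF rel_sq, of t s] by (simp add: int_pow_pow)
qed

lemma z_pow: "z [^] (i::int) = a [^] (2 * h * i) \<otimes> b [^] (2 * h * i)"
  unfolding z_def
  by (subst int_pow_mult_distrib) (simp_all add: even_commute int_pow_pow)

lemma int_pow_cong:
  assumes "x \<in> carrier G" "x [^] (N::int) = \<one>" "N dvd i - j"
  shows "x [^] i = x [^] (j::int)"
proof -
  obtain t where "i = j + N * t"
    using assms(3) by (metis dvd_def diff_eq_eq add.commute)
  then have "x [^] i = x [^] j \<otimes> (x [^] N) [^] t"
    using assms(1) by (simp add: int_pow_mult int_pow_pow)
  then show ?thesis
    using assms by simp
qed

lemma a_cong: "4 * h dvd i - j \<Longrightarrow> a [^] i = a [^] (j::int)"
  and b_cong: "4 * h dvd i - j \<Longrightarrow> b [^] i = b [^] (j::int)"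
  using int_pow_cong rel_a rel_b by blast+

lemma z_sq: "z [^] (2::int) = \<one>"
proof -
  have "2 * h * 2 = 4 * h"
    by simp
  then show ?thesis
    by (simp only: z_pow rel_a rel_b r_one one_closed)
qed

lemma z_cong: "even (i - j) \<Longrightarrow> z [^] i = z [^] (j::int)"
  by (rule int_pow_cong[OF z_closed z_sq])

lemma z_commute_a_even: "even i \<Longrightarrow> z \<otimes> a [^] (i::int) = a [^] i \<otimes> z"
proof -
  assume i: "even i"
  have "z \<otimes> a [^] i = a [^] (2 * h) \<otimes> (a [^] i \<otimes> b [^] (2 * h))"
    using i by (simp add: z_def m_assoc even_commute)
  also have "\<dots> = a [^] (2 * h + i) \<otimes> b [^] (2 * h)"
    by (simp add: m_assoc int_pow_mult)
  also have "\<dots> = a [^] (i + 2 * h) \<otimes> b [^] (2 * h)"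
    by (simp only: add.commute)
  finally show ?thesis
    by (simp add: z_def m_assoc int_pow_mult)
qed

lemma z_commute_b_even: "even i \<Longrightarrow> z \<otimes> b [^] (i::int) = b [^] i \<otimes> z"
proof -
  assume i: "even i"
  have "z \<otimes> b [^] i = a [^] (2 * h) \<otimes> b [^] (2 * h + i)"
    by (simp add: z_def m_assoc int_pow_mult)
  also have "\<dots> = a [^] (2 * h) \<otimes> b [^] i \<otimes> b [^] (2 * h)"
    by (subst add.commute) (simp add: m_assoc int_pow_mult)
  also have "a [^] (2 * h) \<otimes> b [^] i = b [^] i \<otimes> a [^] (2 * h)"
    using i even_commute[of "2 * h" i] by simp
  finally show ?thesis
    by (simp add: z_def m_assoc)
qed

lemma pow_z_pow_l:
  assumes "x \<in> {a, b}"
  shows "(x [^] (- 2::int) \<otimes> z [^] l) [^] (t::int) = x [^] (- 2 * t) \<otimes> z [^] (l * t)"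
proof -
  have "z \<otimes> x [^] (- 2::int) = x [^] (- 2::int) \<otimes> z"
    using assms by (auto simp: z_commute_a_even z_commute_b_even)
  then have "x [^] (- 2::int) \<otimes> z [^] l = z [^] l \<otimes> x [^] (- 2::int)"
    using assms int_pow_commute_left[of z "x [^] (- 2::int)" l] by auto
  then show ?thesis
    using assms by (subst int_pow_mult_distrib) (auto simp: int_pow_pow)
qed

text \<open>Conjugation by \<open>b\<close> is a homomorphism, so \<open>rel_a2b\<close> may be
  raised to the power \<open>t\<close>.\<close>

lemma a_even_b: "a [^] (2 * t) \<otimes> b = b \<otimes> (a [^] (- 2 * t) \<otimes> z [^] (l * t))"
  using int_pow_conj_rule[OF _ _ _ rel_a2b, of t] by (simp add: int_pow_pow pow_z_pow_l)

lemma b_even_a: "b [^] (2 * t) \<otimes> a = a \<otimes> (b [^] (- 2 * t) \<otimes> z [^] (l * t))"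
  using int_pow_conj_rule[OF _ _ _ rel_b2a, of t] by (simp add: int_pow_pow pow_z_pow_l)

text \<open>At \<open>t = h\<close> the inverted power \<open>a^(-2h)\<close> equals
  \<open>a^(2h)\<close> because \<open>a^(4h) = 1\<close>, and \<open>z^(l h)\<close> vanishes
  because \<open>l * h\<close> is even. The restriction on \<open>l\<close> for n = 4 enters
  here.\<close>

lemma a_half_b: "a [^] (2 * h) \<otimes> b = b \<otimes> a [^] (2 * h)"
proof -
  have "z [^] (l * h) = \<one>"
    using z_cong[of "l * h" 0] even_lh by simp
  moreover have "a [^] (- (2 * h)) = a [^] (2 * h)"
    by (rule a_cong) simp
  ultimately show ?thesis
    using a_even_b[of h] by simp
qed

lemma b_half_a: "b [^] (2 * h) \<otimes> a = a \<otimes> b [^] (2 * h)"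
proof -
  have "z [^] (l * h) = \<one>"
    using z_cong[of "l * h" 0] even_lh by simp
  moreover have "b [^] (- (2 * h)) = b [^] (2 * h)"
    by (rule b_cong) simp
  ultimately show ?thesis
    using b_even_a[of h] by simp
qed

lemma z_a: "z \<otimes> a = a \<otimes> z"
proof -
  have "z \<otimes> a = a [^] (2 * h) \<otimes> a \<otimes> b [^] (2 * h)"
    by (simp add: z_def m_assoc b_half_a)
  also have "a [^] (2 * h) \<otimes> a = a \<otimes> a [^] (2 * h)"
    using int_pow_commute_left[of a a "2 * h"] by simp
  finally show ?thesis
    by (simp add: z_def m_assoc)
qed

lemma z_b: "z \<otimes> b = b \<otimes> z"
proof -
  have "z \<otimes> b = a [^] (2 * h) \<otimes> b \<otimes> b [^] (2 * h)"
    using int_pow_commute_left[of b b "2 * h"] by (simp add: z_def m_assoc)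
  then show ?thesis
    by (simp add: z_def m_assoc a_half_b)
qed

lemma z_pow_a: "z [^] (t::int) \<otimes> a [^] (i::int) = a [^] i \<otimes> z [^] t"
  and z_pow_b: "z [^] t \<otimes> b [^] i = b [^] i \<otimes> z [^] t"
  using int_pow_commute[OF z_a, of t i] int_pow_commute[OF z_b, of t i] by auto

lemma z_pow_a_assoc:
  "x \<in> carrier G \<Longrightarrow> z [^] (t::int) \<otimes> (a [^] (i::int) \<otimes> x) = a [^] i \<otimes> (z [^] t \<otimes> x)"
  and z_pow_b_assoc: "x \<in> carrier G \<Longrightarrow> z [^] t \<otimes> (b [^] i \<otimes> x) = b [^] i \<otimes> (z [^] t \<otimes> x)"
  by (simp_all add: m_assoc[symmetric] z_pow_a z_pow_b)

lemma z_pow_z_pow_assoc: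
  "x \<in> carrier G \<Longrightarrow> z [^] (t::int) \<otimes> (z [^] (s::int) \<otimes> x) = z [^] (t + s) \<otimes> x"
  by (simp add: m_assoc[symmetric] int_pow_mult)

lemma a_pow_a_pow_assoc:
  "x \<in> carrier G \<Longrightarrow> a [^] (t::int) \<otimes> (a [^] (s::int) \<otimes> x) = a [^] (t + s) \<otimes> x"
  and b_pow_b_pow_assoc:
  "x \<in> carrier G \<Longrightarrow> b [^] t \<otimes> (b [^] s \<otimes> x) = b [^] (t + s) \<otimes> x"
  by (simp_all add: m_assoc[symmetric] int_pow_mult)

lemmas collect = m_assoc z_pow_a z_pow_b z_pow_a_assoc z_pow_b_assoc z_pow_z_pow_assoc
  a_pow_a_pow_assoc b_pow_b_pow_assoc int_pow_mult[symmetric]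

lemma even_b_a: "b [^] (2 * t) \<otimes> a = a \<otimes> b [^] (- 2 * t) \<otimes> z [^] (l * t)"
  by (simp add: b_even_a m_assoc)

lemma b_a_even: "b \<otimes> a [^] (2 * t) = a [^] (- 2 * t) \<otimes> b \<otimes> z [^] (l * t)"
proof -
  have "a [^] (- 2 * t) \<otimes> b = b \<otimes> (a [^] (2 * t) \<otimes> z [^] (- l * t))"
    using a_even_b[of "- t"] by simp
  then have "a [^] (- 2 * t) \<otimes> b \<otimes> z [^] (l * t) = b \<otimes> (a [^] (2 * t) \<otimes> (z [^] (- l * t) \<otimes> z [^] (l * t)))"
    by (simp add: m_assoc)
  then show ?thesis
    by (simp add: int_pow_mult[symmetric])
qed

lemma even_b_odd_a:
  "b [^] (2 * t) \<otimes> a [^] (2 * s + 1 :: int) = a [^] (2 * s + 1 :: int) \<otimes> b [^] (- 2 * t) \<otimes> z [^] (l * t)"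
proof -
  have "b [^] (2 * t) \<otimes> a [^] (2 * s + 1) = a [^] (2 * s) \<otimes> (b [^] (2 * t) \<otimes> a)"
    by (simp add: int_pow_mult m_assoc[symmetric] even_commute)
  then show ?thesis
    by (simp add: even_b_a m_assoc int_pow_mult)
qed

lemma odd_b_even_a:
  "b [^] (2 * t + 1 :: int) \<otimes> a [^] (2 * s) = a [^] (- 2 * s) \<otimes> b [^] (2 * t + 1 :: int) \<otimes> z [^] (l * s)"
proof -
  have "b [^] (2 * t + 1) \<otimes> a [^] (2 * s) = b [^] (2 * t) \<otimes> (b \<otimes> a [^] (2 * s))"
    by (simp add: int_pow_mult m_assoc)
  also have "\<dots> = (b [^] (2 * t) \<otimes> a [^] (- 2 * s)) \<otimes> b \<otimes> z [^] (l * s)"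
    by (simp add: b_a_even m_assoc)
  also have "\<dots> = a [^] (- 2 * s) \<otimes> b [^] (2 * t) \<otimes> b \<otimes> z [^] (l * s)"
    by (simp add: even_commute)
  finally show ?thesis
    by (simp add: int_pow_mult m_assoc)
qed

text \<open>Expanding by \<open>rel_ba\<close> produces \<open>b a^2\<close>, which the mixed rule
  can move; the commutator relation thereby becomes a collection rule for odd exponents.\<close>

lemma b_a: "b \<otimes> a = a [^] (- 1::int) \<otimes> b [^] (- 1::int) \<otimes> z [^] (k + l)"
proof -
  have "b \<otimes> a = a \<otimes> (b \<otimes> a [^] (2::int)) \<otimes> b [^] (- 2::int) \<otimes> z [^] k"
    by (simp add: rel_ba m_assoc)
  also have "b \<otimes> a [^] (2::int) = a [^] (- 2::int) \<otimes> b \<otimes> z [^] l"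
    using b_a_even[of 1] by simp
  also have "a \<otimes> (a [^] (- 2::int) \<otimes> b \<otimes> z [^] l) \<otimes> b [^] (- 2::int) \<otimes> z [^] k
      = a [^] (1::int) \<otimes> a [^] (- 2::int) \<otimes> b [^] (1::int) \<otimes> z [^] l \<otimes> b [^] (- 2::int) \<otimes> z [^] k"
    by (simp add: m_assoc)
  also have "\<dots> = a [^] (- 1::int) \<otimes> b [^] (- 1::int) \<otimes> z [^] (k + l)"
    by (simp add: collect add.commute del: int_pow_1)
  finally show ?thesis .
qed

lemma odd_b_odd_a:
  "b [^] (2 * t + 1) \<otimes> a [^] (2 * s + 1) =
     a [^] (- (2 * s + 1)) \<otimes> b [^] (- (2 * t + 1)) \<otimes> z [^] (k + l * (s + t + 1))"
proof -
  have "b [^] (2 * t + 1) \<otimes> a [^] (2 * s + 1) = b [^] (2 * t) \<otimes> (b \<otimes> a) \<otimes> a [^] (2 * s)"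
  proof -
    have "2 * s + 1 = 1 + 2 * s"
      by simp
    then show ?thesis
      by (simp only: int_pow_mult a_closed b_closed int_pow_1 m_assoc m_closed int_pow_closed)
  qed
  \<comment> \<open>After \<open>b a\<close> is replaced, each remaining pair has one even exponent.
    Writing -1 as \<open>2 * (- 1) + 1\<close> puts both pairs into the shape of the mixed
    rules.\<close>
  also have "\<dots> = (b [^] (2 * t) \<otimes> a [^] (2 * (- 1) + 1 :: int)) \<otimes> (b [^] (2 * (- 1) + 1 :: int) \<otimes> a [^] (2 * s)) \<otimes> z [^] (k + l)"
    by (simp add: b_a m_assoc z_pow_a)
  also have "\<dots> = a [^] (- 1::int) \<otimes> b [^] (- 2 * t) \<otimes> z [^] (l * t) \<otimes>
      (a [^] (- 2 * s) \<otimes> b [^] (- 1::int) \<otimes> z [^] (l * s)) \<otimes> z [^] (k + l)"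
    by (subst even_b_odd_a, subst odd_b_even_a) simp
  also have "\<dots> = a [^] (- 1::int) \<otimes> (b [^] (- 2 * t) \<otimes> a [^] (- 2 * s)) \<otimes> b [^] (- 1::int) \<otimes>
      z [^] (l * t + l * s + (k + l))"
    by (simp add: collect)
  also have "\<dots> = a [^] (- 1::int) \<otimes> (a [^] (- 2 * s) \<otimes> b [^] (- 2 * t)) \<otimes> b [^] (- 1::int) \<otimes>
      z [^] (l * t + l * s + (k + l))"
    by (simp add: even_commute)
  also have "\<dots> = a [^] (- (2 * s + 1)) \<otimes> b [^] (- (2 * t + 1)) \<otimes> z [^] (k + l * (s + t + 1))"
    by (simp add: collect algebra_simps)
  finally show ?thesis .
qed

text \<open>Exponent of \<open>z\<close> produced by collecting \<open>b^j a^i\<close>, with the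
  exponent of \<open>a\<close> as first argument. It stays an integer although only its parity
  matters, by \<open>z_sq\<close>.\<close>

definition twist :: "int \<Rightarrow> int \<Rightarrow> int" where
  "twist i j =
     (if even i then if even j then 0 else l * (i div 2)
      else if even j then l * (j div 2) else k + l * ((i + j) div 2))"

lemma b_pow_a_pow:
  "b [^] (j::int) \<otimes> a [^] (i::int) =
     a [^] (if even j then i else - i) \<otimes> b [^] (if even i then j else - j) \<otimes> z [^] twist i j"
proof -
  have div2: "(2 * t + 1 + (2 * s + 1)) div 2 = s + t + 1" for s t :: int
    by presburger
  consider s t where "i = 2 * s" "j = 2 * t" | s t where "i = 2 * s" "j = 2 * t + 1"
    | s t where "i = 2 * s + 1" "j = 2 * t" | s t where "i = 2 * s + 1" "j = 2 * t + 1"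
    by (metis evenE oddE)
  then show ?thesis
    using even_commute[of i j] odd_b_even_a even_b_odd_a odd_b_odd_a
    by cases (simp_all add: twist_def div2 add.commute)
qed

text \<open>Most relations exchange in pairs. Only the commutator relation needs an argument: the
  exchanged correction \<open>b^2 a^(-2) z^k\<close> is the inverse of
  \<open>a^2 b^(-2) z^k\<close>, since even powers commute and \<open>z\<close> is central with
  \<open>z^2 = 1\<close>.\<close>

lemma swap: "G2_relations G h k l b a z"
proof
  show "z = b [^] (2 * h) \<otimes> a [^] (2 * h)"
    by (simp add: z_def even_commute)
  have "z [^] k \<otimes> z [^] k = \<one>"
    using z_cong[of "k + k" 0] by (simp add: int_pow_mult[symmetric])
  moreover have "b [^] (- 2::int) \<otimes> (a [^] (- 2::int) \<otimes> b [^] (2::int)) = a [^] (- 2::int)"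
    using even_commute[of "- 2" 2] by (simp flip: even_commute) (simp add: collect)
  ultimately have "b \<otimes> a \<otimes> (b [^] (2::int) \<otimes> a [^] (- 2::int) \<otimes> z [^] k) = a \<otimes> b"
    unfolding rel_ba
    by (simp add: collect even_commute)
  then show "a \<otimes> b = b \<otimes> a \<otimes> (b [^] (2::int) \<otimes> a [^] (- 2::int) \<otimes> z [^] k)"
    by simp
qed (use h_pos k l odd_h rel_a rel_b rel_sq rel_a2b rel_b2a in auto)

end

section \<open>Homomorphisms from presented groups\<close>

lemma (in group) r_coset_eq_iff:
  assumes "subgroup N G" "x \<in> carrier G" "y \<in> carrier G"
  shows "N #> x = N #> y \<longleftrightarrow> x \<otimes> inv y \<in> N"
  using assms coset_join2[of "x \<otimes> inv y" N] coset_join1[of N "x \<otimes> inv y"]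
    coset_mult_inv1[of N x y] coset_mult_inv2[of N x y] subgroup.subset
  by (metis inv_closed m_closed)

definition letter_eval :: "('a, 'c) monoid_scheme \<Rightarrow> ('g \<Rightarrow> 'a) \<Rightarrow> 'g \<times> bool \<Rightarrow> 'a" where
  "letter_eval G f x = (if snd x then inv\<^bsub>G\<^esub> f (fst x) else f (fst x))"

definition word_eval :: "('a, 'c) monoid_scheme \<Rightarrow> ('g \<Rightarrow> 'a) \<Rightarrow> 'g word \<Rightarrow> 'a" where
  "word_eval G f w = foldr (\<lambda>x y. letter_eval G f x \<otimes>\<^bsub>G\<^esub> y) w \<one>\<^bsub>G\<^esub>"

context group
begin

context
  fixes f :: "'g \<Rightarrow> 'a"
  assumes f: "\<And>x. f x \<in> carrier G"
begin

lemma letter_eval_closed [simp]: "letter_eval G f x \<in> carrier G"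
  using f by (simp add: letter_eval_def)

lemma word_eval_Nil [simp]: "word_eval G f [] = \<one>"
  and word_eval_Cons [simp]: "word_eval G f (x # w) = letter_eval G f x \<otimes> word_eval G f w"
  by (simp_all add: word_eval_def)

lemma word_eval_closed [simp]: "word_eval G f w \<in> carrier G"
  by (induction w) auto

lemma letter_eval_flip: "letter_eval G f (flip x) = inv (letter_eval G f x)"
  using f by (simp add: letter_eval_def flip_def)

text \<open>Cancelling a letter against its flip is invisible after evaluation; this is what makes
  evaluation a homomorphism although the product of the free group reduces words.\<close>

lemma word_eval_lmult: "word_eval G f (lmult x w) = letter_eval G f x \<otimes> word_eval G f w"
  by (cases w) (auto simp: letter_eval_flip)

lemma word_eval_hom: "word_eval G f \<in> hom free_group G"
proof (rule homI)
  show "word_eval G f (u \<otimes>\<^bsub>free_group\<^esub> v) = word_eval G f u \<otimes> word_eval G f v" for u v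
    by (induction u) (auto simp: free_group_def word_eval_lmult m_assoc)
qed simp

lemma word_eval_free_gen: "word_eval G f (free_gen x) = f x"
  using f by (simp add: free_gen_def letter_eval_def)

end

end

lemma generate_free_gen: "generate free_group (range free_gen) = carrier free_group"
proof -
  interpret F: group free_group
    by (rule group_free_group)
  have letter: "[x] \<in> generate free_group (range free_gen)" for x :: "'a \<times> bool"
  proof (cases "snd x")
    case False
    then have "[x] = free_gen (fst x)"
      by (simp add: free_gen_def prod_eq_iff)
    then show ?thesis
      by (auto intro: generate.incl)
  next
    case True
    then have "[x] \<otimes>\<^bsub>free_group\<^esub> free_gen (fst x) = \<one>\<^bsub>free_group\<^esub>"
      by (simp add: free_gen_def free_group_def flip_def)
    then have "inv\<^bsub>free_group\<^esub> free_gen (fst x) = [x]"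
      by (rule F.inv_equality) (simp_all add: free_gen_closed, simp add: free_group_def)
    then show ?thesis
      by (metis generate.inv rangeI)
  qed
  have "reduced w \<Longrightarrow> w \<in> generate free_group (range free_gen)" for w :: "'a word"
  proof (induction w)
    case Nil
    then show ?case
      using generate.one[of free_group "range free_gen"] by (simp add: free_group_def)
  next
    case (Cons x w)
    then have "x # w = [x] \<otimes>\<^bsub>free_group\<^esub> w"
      by (simp add: free_group_def lmult_reduced)
    then show ?case
      using Cons letter by (metis generate.eng reduced_ConsD)
  qed
  moreover have "generate free_group (range free_gen) \<subseteq> (carrier free_group :: 'a word set)"
    by (rule F.generate_incl) (auto simp: free_gen_closed)
  ultimately show ?thesis
    by (auto simp: free_group_def)
qed

locale presentation =
  fixes R :: "('g word \<times> 'g word) set"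
  assumes rels_closed: "\<And>u v. (u, v) \<in> R \<Longrightarrow> u \<in> carrier free_group \<and> v \<in> carrier free_group"
begin

sublocale F: group "free_group :: 'g word monoid"
  by (rule group_free_group)

lemma relator_closure_normal: "relator_closure R \<lhd> free_group"
  unfolding relator_closure_def using rels_closed by (intro F.normal_normal_closure) auto

sublocale P: group "presented_group R"
  using group_presented_group rels_closed by blast

lemma coset_hom: "(\<lambda>w. relator_closure R #>\<^bsub>free_group\<^esub> w) \<in> hom free_group (presented_group R)"
  unfolding presented_group_def by (rule normal.r_coset_hom_Mod[OF relator_closure_normal])

lemma coset_relation:
  assumes "(u, v) \<in> R"
  shows "relator_closure R #>\<^bsub>free_group\<^esub> u = relator_closure R #>\<^bsub>free_group\<^esub> v"
proof -
  have "u \<otimes>\<^bsub>free_group\<^esub> inv\<^bsub>free_group\<^esub> v \<in> relator_closure R"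
    using assms unfolding relator_closure_def normal_closure_def by force
  then show ?thesis
    using F.r_coset_eq_iff[OF normal_imp_subgroup[OF relator_closure_normal], of u v]
      rels_closed[OF assms] by blast
qed

lemma presented_gen_closed: "presented_gen R x \<in> carrier (presented_group R)"
  using hom_in_carrier[OF coset_hom free_gen_closed] by (simp add: presented_gen_def)

lemma generate_presented_gen:
  "generate (presented_group R) (range (presented_gen R)) = carrier (presented_group R)"
proof -
  interpret q: group_hom free_group "presented_group R" "\<lambda>w. relator_closure R #>\<^bsub>free_group\<^esub> w"
    by unfold_locales (rule coset_hom)
  have "range (presented_gen R) = (\<lambda>w. relator_closure R #>\<^bsub>free_group\<^esub> w) ` range free_gen"
    by (auto simp: presented_gen_def)
  then have "generate (presented_group R) (range (presented_gen R)) =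
      (\<lambda>w. relator_closure R #>\<^bsub>free_group\<^esub> w) ` carrier free_group"
    using q.generate_img[of "range free_gen"] by (simp add: image_subset_iff free_gen_closed generate_free_gen)
  then show ?thesis
    by (simp add: presented_group_def carrier_FactGroup)
qed

text \<open>Von Dyck's theorem: the kernel of word evaluation is normal and contains all relators,
  hence also their normal closure, so evaluation factors through the quotient.\<close>

lemma presented_group_universal:
  assumes H: "group H" and f: "\<And>x. f x \<in> carrier H"
    and rels: "\<And>u v. (u, v) \<in> R \<Longrightarrow> word_eval H f u = word_eval H f v"
  obtains \<phi> where "\<phi> \<in> hom (presented_group R) H" "\<And>x. \<phi> (presented_gen R x) = f x"
proof -
  interpret H: group H
    by (rule H)
  interpret h: group_hom free_group H "word_eval H f"
    by unfold_locales (rule H.word_eval_hom[OF f])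
  have "(\<lambda>(u, v). u \<otimes>\<^bsub>free_group\<^esub> inv\<^bsub>free_group\<^esub> v) ` R \<subseteq> kernel free_group H (word_eval H f)"
    using rels rels_closed H.word_eval_closed[OF f] by (auto simp: kernel_def)
  then have "relator_closure R \<subseteq> kernel free_group H (word_eval H f)"
    unfolding relator_closure_def normal_closure_def using h.normal_kernel by blast
  then obtain \<phi> where hom: "\<phi> \<in> hom (presented_group R) H"
    and \<phi>: "\<And>w. w \<in> carrier free_group \<Longrightarrow> \<phi> (relator_closure R #>\<^bsub>free_group\<^esub> w) = word_eval H f w"
    using h.FactGroup_universal_kernel[OF relator_closure_normal] unfolding presented_group_def by metis
  show ?thesis
    by (rule that[OF hom]) (simp add: presented_gen_def \<phi> free_gen_closed H.word_eval_free_gen[of f, OF f])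
qed

end

lemma hom_eq_on_generate:
  assumes "group G" "group H" "\<phi> \<in> hom G H" "\<psi> \<in> hom G H" "S \<subseteq> carrier G"
    and "\<And>x. x \<in> S \<Longrightarrow> \<phi> x = \<psi> x" and "x \<in> generate G S"
  shows "\<phi> x = \<psi> x"
proof -
  interpret G: group G by fact
  interpret \<phi>: group_hom G H \<phi> using assms by (simp add: group_hom_def group_hom_axioms_def)
  interpret \<psi>: group_hom G H \<psi> using assms by (simp add: group_hom_def group_hom_axioms_def)
  show ?thesis
    using assms(7)
  proof (induction rule: generate.induct)
    case (eng x y)
    then show ?case
      using G.generate_in_carrier[OF assms(5)] by simp
  qed (use assms in auto)
qed

section \<open>The relations of \<open>G2\<close> as equations in an arbitrary group\<close>

definition satisfies_G2_rels ::
    "('a, 'c) monoid_scheme \<Rightarrow> nat \<Rightarrow> nat \<Rightarrow> nat \<Rightarrow> 'a \<Rightarrow> 'a \<Rightarrow> bool" where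
  "satisfies_G2_rels G e k l a b \<longleftrightarrow>
    (let n = (2::nat) ^ e; z = a [^]\<^bsub>G\<^esub> (n div 2) \<otimes>\<^bsub>G\<^esub> b [^]\<^bsub>G\<^esub> (n div 2)
     in a [^]\<^bsub>G\<^esub> n = \<one>\<^bsub>G\<^esub> \<and> b [^]\<^bsub>G\<^esub> n = \<one>\<^bsub>G\<^esub> \<and>
        commutator G (b [^]\<^bsub>G\<^esub> (2::nat)) (a [^]\<^bsub>G\<^esub> (2::nat)) = \<one>\<^bsub>G\<^esub> \<and>
        commutator G b a = a [^]\<^bsub>G\<^esub> (2::int) \<otimes>\<^bsub>G\<^esub> b [^]\<^bsub>G\<^esub> (-2::int) \<otimes>\<^bsub>G\<^esub> z [^]\<^bsub>G\<^esub> k \<and>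
        conj_by G (b [^]\<^bsub>G\<^esub> (2::nat)) a = b [^]\<^bsub>G\<^esub> (-2::int) \<otimes>\<^bsub>G\<^esub> z [^]\<^bsub>G\<^esub> l \<and>
        conj_by G (a [^]\<^bsub>G\<^esub> (2::nat)) b = a [^]\<^bsub>G\<^esub> (-2::int) \<otimes>\<^bsub>G\<^esub> z [^]\<^bsub>G\<^esub> l)"

text \<open>Bridge between relations as pairs of words and equations in a group. An arbitrary
  homomorphism is allowed because two are needed: the quotient map shows that \<open>G2\<close>
  satisfies the relations, and word evaluation feeds the universal property.\<close>

lemma hom_G2_rels:
  assumes "group H" "\<phi> \<in> hom free_group H"
  shows "(\<forall>(u, v) \<in> G2_rels e k l. \<phi> u = \<phi> v) \<longleftrightarrow>
    satisfies_G2_rels H e k l (\<phi> (free_gen GenA)) (\<phi> (free_gen GenB))"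
proof -
  interpret F: group "free_group :: gen2 word monoid"
    by (rule group_free_group)
  interpret h: group_hom free_group H \<phi>
    using assms group_free_group by (simp add: group_hom_def group_hom_axioms_def)
  show ?thesis
    by (simp add: G2_rels_def satisfies_G2_rels_def Let_def free_gen_closed commutator_def conj_by_def
        h.hom_nat_pow h.hom_int_pow)
qed

interpretation G2: presentation "G2_rels e k l"
proof -
  interpret group "free_group :: gen2 word monoid"
    by (rule group_free_group)
  show "presentation (G2_rels e k l)"
    by unfold_locales
      (auto simp: G2_rels_def Let_def commutator_def conj_by_def free_gen_closed)
qed

lemma G2_gens_closed: "G2_a e k l \<in> carrier (G2 e k l)" "G2_b e k l \<in> carrier (G2 e k l)"
  by (simp_all add: G2_def G2_a_def G2_b_def G2.presented_gen_closed)

lemma G2_satisfies_rels: "satisfies_G2_rels (G2 e k l) e k l (G2_a e k l) (G2_b e k l)"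
proof -
  have "\<forall>(u, v) \<in> G2_rels e k l. relator_closure (G2_rels e k l) #>\<^bsub>free_group\<^esub> u =
      relator_closure (G2_rels e k l) #>\<^bsub>free_group\<^esub> v"
    using G2.coset_relation by blast
  then show ?thesis
    using hom_G2_rels[OF G2.P.is_group G2.coset_hom, of e k l e k l]
    by (simp only: G2_def G2_a_def G2_b_def presented_gen_def)
qed

lemma UNIV_gen2: "UNIV = {GenA, GenB}"
  using gen2.exhaust by blast

lemma G2_generated: "generate (G2 e k l) {G2_a e k l, G2_b e k l} = carrier (G2 e k l)"
proof -
  have "range f = {f GenA, f GenB}" for f :: "gen2 \<Rightarrow> gen2 word set"
    using UNIV_gen2 by (metis image_empty image_insert)
  then show ?thesis
    using G2.generate_presented_gen[of e k l] by (simp add: G2_def G2_a_def G2_b_def)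
qed

lemma G2_universal:
  assumes H: "group H" and "a \<in> carrier H" "b \<in> carrier H" and "satisfies_G2_rels H e k l a b"
  obtains \<phi> where "\<phi> \<in> hom (G2 e k l) H" "\<phi> (G2_a e k l) = a" "\<phi> (G2_b e k l) = b"
proof -
  define f where "f = case_gen2 a b"
  have f: "f x \<in> carrier H" for x
    using assms by (cases x) (auto simp: f_def)
  have "\<forall>(u, v) \<in> G2_rels e k l. word_eval H f u = word_eval H f v"
    unfolding hom_G2_rels[OF H group.word_eval_hom[OF H, of f, OF f]] group.word_eval_free_gen[OF H, of f, OF f]
    using assms by (simp add: f_def)
  then obtain \<phi> where "\<phi> \<in> hom (G2 e k l) H" and \<phi>: "\<And>x. \<phi> (presented_gen (G2_rels e k l) x) = f x"
    using G2.presented_group_universal[OF H, where f = f] f unfolding G2_def by blast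
  then show ?thesis
    using that \<phi>[of GenA] \<phi>[of GenB] by (simp add: G2_a_def G2_b_def f_def)
qed

lemma satisfies_G2_rels_iff:
  fixes G (structure)
  assumes "group G" "e \<ge> 2" "k \<in> {0, 1}" "l \<in> {0, 1}" "e = 2 \<Longrightarrow> k = 0 \<and> l = 0"
    and "a \<in> carrier G" "b \<in> carrier G"
  shows "satisfies_G2_rels G e k l a b \<longleftrightarrow>
    G2_relations G (2 ^ (e - 2)) (int k) (int l) a b (a [^] (2 * 2 ^ (e - 2) :: int) \<otimes> b [^] (2 * 2 ^ (e - 2) :: int))"
proof -
  interpret group G by fact
  obtain d where d: "e = Suc (Suc d)"
    using assms(2) by (metis Suc_1 Suc_le_D Suc_le_mono le_Suc_eq numeral_2_eq_2)
  define h :: nat where "h = 2 ^ d"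
  have pow: "x [^] (4 * h) = x [^] (4 * int h)" "x [^] (2 * h) = x [^] (2 * int h)"
      "x [^] (2::nat) = x [^] (2::int)" "x [^] k = x [^] int k" "x [^] l = x [^] int l" for x
    using int_pow_int[of G x "4 * h"] int_pow_int[of G x "2 * h"] int_pow_int[of G x 2]
      int_pow_int[of G x k] int_pow_int[of G x l] by simp_all
  have h: "(2::nat) ^ e = 4 * h" "4 * h div 2 = 2 * h" "(2::int) ^ (e - 2) = int h"
    by (simp_all add: d h_def)
  have eqs: "inv x \<otimes> inv y \<otimes> x \<otimes> y = w \<longleftrightarrow> x \<otimes> y = y \<otimes> x \<otimes> w"
    "inv y \<otimes> x \<otimes> y = w \<longleftrightarrow> x \<otimes> y = y \<otimes> w"
    if "x \<in> carrier G" "y \<in> carrier G" "w \<in> carrier G" for x y w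
    using that by (simp_all add: m_assoc inv_solve_left')
  \<comment> \<open>As a power of 2, \<open>h\<close> is odd only for e = 2; this turns the
    hypothesis on \<open>k\<close> and \<open>l\<close> into the parity condition of the
    locale.\<close>
  have "odd h \<Longrightarrow> e = 2"
    by (cases d) (simp_all add: h_def d)
  then have ax: "int h > 0" "int k \<in> {0, 1}" "int l \<in> {0, 1}" "odd (int h) \<Longrightarrow> int k = 0 \<and> int l = 0"
    using assms by (auto simp: h_def)
  show ?thesis
    unfolding satisfies_G2_rels_def G2_relations_def G2_relations_axioms_def Let_def h pow commutator_def conj_by_def
    using assms ax by (auto simp: eqs simp del: of_nat_0_less_iff)
qed

section \<open>A permutation representation modulo n\<close>

text \<open>Multiplying each relation by a square on the right and moving the central powers of
  \<open>z\<close> removes all inverses. In the model only compositions of \<open>act_a\<close>,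
  \<open>act_b\<close> and \<open>act_z\<close> then have to be evaluated, never inverse
  permutations.\<close>

lemma (in group) G2_relationsI:
  fixes h k l :: int
  assumes "h > 0" "k \<in> {0, 1}" "l \<in> {0, 1}" "odd h \<Longrightarrow> k = 0 \<and> l = 0"
    and ab [simp]: "a \<in> carrier G" "b \<in> carrier G"
    and z: "z = a [^] (2 * h) \<otimes> b [^] (2 * h)"
    and "a [^] (4 * h) = \<one>" "b [^] (4 * h) = \<one>"
    and za: "z \<otimes> a = a \<otimes> z" and zb: "z \<otimes> b = b \<otimes> z"
    and sq: "b \<otimes> b \<otimes> a \<otimes> a = a \<otimes> a \<otimes> b \<otimes> b"
    and ba: "b \<otimes> a \<otimes> b \<otimes> b = a \<otimes> b \<otimes> a \<otimes> a \<otimes> z [^] k"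
    and b2a: "b \<otimes> b \<otimes> a \<otimes> b \<otimes> b = a \<otimes> z [^] l"
    and a2b: "a \<otimes> a \<otimes> b \<otimes> a \<otimes> a = b \<otimes> z [^] l"
  shows "G2_relations G h k l a b z"
proof -
  have [simp]: "z \<in> carrier G"
    by (simp add: z)
  have two: "x [^] (2::int) = x \<otimes> x" "x [^] (- 2::int) = inv (x \<otimes> x)" if "x \<in> carrier G" for x
    using that int_pow_mult[of x 1 1] int_pow_neg[of x 2] by simp_all
  have zc: "z [^] t \<otimes> inv (x \<otimes> x) = inv (x \<otimes> x) \<otimes> z [^] t" if "x \<in> {a, b}" for t :: int and x
    using that za zb int_pow_commute[of z x t "- 2"] by (auto simp: two)
  have move: "u = v \<otimes> (inv (x \<otimes> x) \<otimes> z [^] t)"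
    if "u \<otimes> x \<otimes> x = v \<otimes> z [^] t" "x \<in> {a, b}" "u \<in> carrier G" "v \<in> carrier G" for u v x and t :: int
  proof -
    have [simp]: "x \<in> carrier G"
      using that by auto
    have "u = u \<otimes> x \<otimes> x \<otimes> inv (x \<otimes> x)"
      using that(3) by (simp add: m_assoc)
    also have "\<dots> = v \<otimes> z [^] t \<otimes> inv (x \<otimes> x)"
      by (simp only: that(1))
    also have "\<dots> = v \<otimes> (z [^] t \<otimes> inv (x \<otimes> x))"
      using that by (simp add: m_assoc)
    finally show ?thesis
      using zc that by simp
  qed
  show ?thesis
  proof
    show "b \<otimes> a = a \<otimes> b \<otimes> (a [^] (2::int) \<otimes> b [^] (- 2::int) \<otimes> z [^] k)"
      using move[of "b \<otimes> a" b "a \<otimes> b \<otimes> a \<otimes> a" k] ba by (simp add: two m_assoc)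
    show "b [^] (2::int) \<otimes> a = a \<otimes> (b [^] (- 2::int) \<otimes> z [^] l)"
      using move[of "b \<otimes> b \<otimes> a" b a l] b2a by (simp add: two)
    show "a [^] (2::int) \<otimes> b = b \<otimes> (a [^] (- 2::int) \<otimes> z [^] l)"
      using move[of "a \<otimes> a \<otimes> b" a b l] a2b by (simp add: two)
    show "b [^] (2::int) \<otimes> a [^] (2::int) = a [^] (2::int) \<otimes> b [^] (2::int)"
      using sq by (simp add: two m_assoc)
  qed (use assms in auto)
qed

section \<open>Permutations respecting an equivalence relation\<close>

text \<open>A substitute for permuting equivalence classes: bijections of the underlying type that
  respect \<open>E\<close> in both directions, with those of equal effect on classes identified
  later through the normal subgroup \<open>stabilizing_perms E\<close>.\<close>

definition perm_group :: "('x \<Rightarrow> 'x \<Rightarrow> bool) \<Rightarrow> ('x \<Rightarrow> 'x) monoid" where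
  "perm_group E = \<lparr>carrier = {f. bij f \<and> (\<forall>x y. E (f x) (f y) \<longleftrightarrow> E x y)}, monoid.mult = (\<circ>), one = id\<rparr>"

definition stabilizing_perms :: "('x \<Rightarrow> 'x \<Rightarrow> bool) \<Rightarrow> ('x \<Rightarrow> 'x) set" where
  "stabilizing_perms E = {f \<in> carrier (perm_group E). \<forall>x. E (f x) x}"

lemma perm_group_simps [simp]:
  "f \<otimes>\<^bsub>perm_group E\<^esub> g = f \<circ> g" "\<one>\<^bsub>perm_group E\<^esub> = id"
  "f \<in> carrier (perm_group E) \<longleftrightarrow> bij f \<and> (\<forall>x y. E (f x) (f y) \<longleftrightarrow> E x y)"
  by (auto simp: perm_group_def)

lemma group_perm_group: "group (perm_group E)"
proof (rule groupI)
  fix f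
  assume f: "f \<in> carrier (perm_group E)"
  then have "E (inv_into UNIV f x) (inv_into UNIV f y) \<longleftrightarrow> E x y" for x y
    by (metis bij_inv_eq_iff perm_group_simps(3))
  then show "\<exists>g \<in> carrier (perm_group E). g \<otimes>\<^bsub>perm_group E\<^esub> f = \<one>\<^bsub>perm_group E\<^esub>"
    using f by (intro bexI[of _ "inv_into UNIV f"]) (auto simp: bij_imp_bij_inv bij_is_inj)
qed (auto simp: bij_comp comp_assoc)

lemma inv_perm_group:
  assumes "f \<in> carrier (perm_group E)"
  shows "inv\<^bsub>perm_group E\<^esub> f = inv_into UNIV f"
proof -
  interpret group "perm_group E"
    by (rule group_perm_group)
  have "inv\<^bsub>perm_group E\<^esub> f \<circ> f = id"
    using l_inv[OF assms] by simp
  then show ?thesis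
    using assms by (metis bij_is_surj comp_assoc comp_id id_comp perm_group_simps(3) surj_iff)
qed

context
  fixes E :: "'x \<Rightarrow> 'x \<Rightarrow> bool"
  assumes E: "equivp E"
begin

lemma stabilizing_perms_normal: "stabilizing_perms E \<lhd> perm_group E"
proof -
  interpret group "perm_group E"
    by (rule group_perm_group)
  show ?thesis
  proof (rule normal_invI)
    show "subgroup (stabilizing_perms E) (perm_group E)"
    proof (rule subgroupI)
      show "stabilizing_perms E \<noteq> {}"
        using E one_closed by (auto simp: stabilizing_perms_def equivp_reflp intro!: exI[of _ id])
      show "inv\<^bsub>perm_group E\<^esub> f \<in> stabilizing_perms E" if f: "f \<in> stabilizing_perms E" for f
      proof -
        have c: "f \<in> carrier (perm_group E)"
          using f by (simp add: stabilizing_perms_def)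
        have "E (inv_into UNIV f x) x" for x
          using f E c by (metis (mono_tags, lifting) bij_inv_eq_iff equivp_symp mem_Collect_eq
              perm_group_simps(3) stabilizing_perms_def)
        then show ?thesis
          using inv_closed[OF c] unfolding stabilizing_perms_def inv_perm_group[OF c] by blast
      qed
      show "f \<otimes>\<^bsub>perm_group E\<^esub> g \<in> stabilizing_perms E"
        if "f \<in> stabilizing_perms E" "g \<in> stabilizing_perms E" for f g
        using that equivp_transp[OF E] by (auto simp: stabilizing_perms_def bij_comp) blast
    qed (auto simp: stabilizing_perms_def)
    show "f \<otimes>\<^bsub>perm_group E\<^esub> g \<otimes>\<^bsub>perm_group E\<^esub> inv\<^bsub>perm_group E\<^esub> f \<in> stabilizing_perms E"
      if f: "f \<in> carrier (perm_group E)" and g: "g \<in> stabilizing_perms E" for f g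
    proof -
      have gc: "g \<in> carrier (perm_group E)"
        using g by (simp add: stabilizing_perms_def)
      have "E ((f \<circ> g \<circ> inv_into UNIV f) x) x" for x
      proof -
        have "E (g (inv_into UNIV f x)) (inv_into UNIV f x)"
          using g by (simp add: stabilizing_perms_def)
        then have "E (f (g (inv_into UNIV f x))) (f (inv_into UNIV f x))"
          using f by simp
        moreover have "f (inv_into UNIV f x) = x"
          using f by (simp add: bij_is_surj surj_f_inv_f)
        ultimately show ?thesis
          by simp
      qed
      then show ?thesis
        using f gc m_closed[OF m_closed[OF f gc] inv_closed[OF f]]
        unfolding stabilizing_perms_def inv_perm_group[OF f] by simp
    qed
  qed
qed

lemma stabilizing_perms_coset_eq:
  assumes f: "f \<in> carrier (perm_group E)" and g: "g \<in> carrier (perm_group E)"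
  shows "stabilizing_perms E #>\<^bsub>perm_group E\<^esub> f = stabilizing_perms E #>\<^bsub>perm_group E\<^esub> g \<longleftrightarrow>
    (\<forall>x. E (f x) (g x))"
proof -
  interpret group "perm_group E"
    by (rule group_perm_group)
  have "f \<otimes>\<^bsub>perm_group E\<^esub> inv\<^bsub>perm_group E\<^esub> g \<in> stabilizing_perms E \<longleftrightarrow> (\<forall>x. E (f (inv_into UNIV g x)) x)"
    using m_closed[OF f inv_closed[OF g]] unfolding stabilizing_perms_def inv_perm_group[OF g] by simp
  also have "\<dots> \<longleftrightarrow> (\<forall>x. E (f x) (g x))"
    using g by (metis bij_inv_eq_iff perm_group_simps(3))
  finally show ?thesis
    using r_coset_eq_iff[OF normal_imp_subgroup[OF stabilizing_perms_normal] f g] by simp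
qed

end

lemma pow_perm_group: "f [^]\<^bsub>perm_group E\<^esub> (n::nat) = f ^^ n"
  by (induction n) (simp_all add: nat_pow_def flip: funpow_Suc_right)

definition pair_cong :: "int \<Rightarrow> int \<times> int \<Rightarrow> int \<times> int \<Rightarrow> bool" where
  "pair_cong n x y \<longleftrightarrow> n dvd fst x - fst y \<and> n dvd snd x - snd y"

lemma equivp_pair_cong: "equivp (pair_cong n)"
proof (rule equivpI)
  show "symp (pair_cong n)"
    by (auto simp: symp_def pair_cong_def dvd_diff_commute)
  show "transp (pair_cong n)"
    unfolding transp_def pair_cong_def
    by (metis dvd_add diff_add_cancel diff_diff_eq2 add_diff_eq)
qed (auto simp: reflp_def pair_cong_def)

section \<open>The action on exponent pairs\<close>

locale G2_model =
  fixes h k l :: int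
  assumes h_pos: "h > 0"
    and k: "k \<in> {0, 1}" and l: "l \<in> {0, 1}" and odd_h: "odd h \<Longrightarrow> k = 0 \<and> l = 0"
begin

abbreviation eqv :: "int \<times> int \<Rightarrow> int \<times> int \<Rightarrow> bool" (infix "\<doteq>" 50) where
  "(\<doteq>) \<equiv> pair_cong (4 * h)"

text \<open>Exponent of \<open>z\<close> arising when \<open>b\<close> is moved past
  \<open>a^i\<close>. Reducing the coefficient of \<open>l\<close> modulo 2, harmless since
  \<open>z^2 = 1\<close>, makes \<open>shift\<close> truly periodic, so \<open>act_b\<close> is
  invertible exactly and not just up to congruence.\<close>

definition shift :: "int \<Rightarrow> int" where
  "shift i = (if even i then l * ((i div 2) mod 2) else k + l * (((i + 1) div 2) mod 2))"

text \<open>\<open>shift\<close> depends only on \<open>i\<close> modulo 4. For even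
  \<open>h\<close> the increment is a multiple of 4; for odd \<open>h\<close> both \<open>k\<close>
  and \<open>l\<close> vanish and \<open>shift\<close> is zero.\<close>

lemma shift_period: "shift (i + 2 * h * x) = shift i"
proof (cases "even h")
  case True
  then obtain g where "h = 2 * g"
    by (elim evenE)
  then have h: "2 * h * x = 4 * (g * x)"
    by simp
  have "(i + 4 * y) div 2 mod 2 = i div 2 mod 2" "(i + 4 * y + 1) div 2 mod 2 = (i + 1) div 2 mod 2"
    "even (i + 4 * y) = even i" for y :: int
    by presburger+
  then show ?thesis
    by (simp only: shift_def h)
next
  case False
  then show ?thesis
    using odd_h unfolding shift_def by simp
qed

lemma shift_uminus: "shift (- i) = (if even i then shift i else 2 * k + l - shift i)"
proof -
  have "even i \<Longrightarrow> (- i) div 2 mod 2 = i div 2 mod 2"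
    "odd i \<Longrightarrow> (- i + 1) div 2 mod 2 = 1 - (i + 1) div 2 mod 2"
    by presburger+
  then show ?thesis
    by (simp add: shift_def right_diff_distrib)
qed

lemma shift_add_1: "shift (i + 1) = (if even i then k + l - shift i else shift i - k)"
proof -
  have "even i \<Longrightarrow> (i + 1 + 1) div 2 mod 2 = 1 - i div 2 mod 2"
    by presburger
  then show ?thesis
    by (simp add: shift_def right_diff_distrib)
qed

lemma shift_add_2: "shift (i + 2) = (if even i then l else 2 * k + l) - shift i"
  using shift_add_1[of i] shift_add_1[of "i + 1"] by (auto simp: add.assoc)

definition act_a :: "int \<times> int \<Rightarrow> int \<times> int" where
  "act_a x = (fst x + 1, snd x)"

text \<open>Left multiplication by \<open>b\<close> on the normal forms \<open>a\<^sup>i b\<^sup>j\<close>; the summand \<open>2 * h * shift i\<close>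
  accounts for the power of the central element \<open>z\<close>.\<close>

definition act_b :: "int \<times> int \<Rightarrow> int \<times> int" where
  "act_b x = (- fst x + 2 * h * shift (fst x),
     (if even (fst x) then snd x + 1 else snd x - 1) + 2 * h * shift (fst x))"

text \<open>Found by solving \<open>act_b\<close> for its argument: the preimage has first exponent
  \<open>- i\<close> up to a multiple of \<open>2 * h\<close>, where \<open>i\<close> is the given
  one, so by periodicity its shift is \<open>shift (- i)\<close>.\<close>

definition act_b_inv :: "int \<times> int \<Rightarrow> int \<times> int" where
  "act_b_inv x = (- fst x + 2 * h * shift (- fst x),
     (if even (fst x) then snd x - 1 else snd x + 1) - 2 * h * shift (- fst x))"

lemma even_2h: "even (i + 2 * h * x) = even i" "even (2 * h * x + i) = even i" "even (2 * h * x - i) = even i"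
  by auto

lemma act_b_inverse: "act_b (act_b_inv x) = x" "act_b_inv (act_b x) = x"
proof -
  have "shift (- (- i + 2 * h * shift i)) = shift i" for i
    using shift_period[of i "- shift i"] by simp
  moreover have "shift (- i + 2 * h * shift (- i)) = shift (- i)" for i
    using shift_period[of "- i" "shift (- i)"] by simp
  ultimately show "act_b (act_b_inv x) = x" "act_b_inv (act_b x) = x"
    by (simp_all add: act_b_def act_b_inv_def even_2h prod_eq_iff)
qed

lemma act_a_closed: "act_a \<in> carrier (perm_group (\<doteq>))"
proof -
  have "bij act_a"
    by (rule o_bij[of "\<lambda>x. (fst x - 1, snd x)"]) (auto simp: act_a_def)
  then show ?thesis
    by (simp add: act_a_def pair_cong_def)
qed

lemma cong_4h_iff: "(4 * h dvd i - j) = (\<exists>t. i = j + 4 * h * t)"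
  by (metis add_diff_cancel_left' dvd_def add.commute diff_add_cancel)

lemma act_b_cong: "x \<doteq> y \<Longrightarrow> act_b x \<doteq> act_b y"
  and act_b_inv_cong: "x \<doteq> y \<Longrightarrow> act_b_inv x \<doteq> act_b_inv y"
proof -
  assume "x \<doteq> y"
  then obtain s t where *: "fst x = fst y + 4 * h * s" "snd x = snd y + 4 * h * t"
    unfolding pair_cong_def cong_4h_iff by blast
  have "shift (fst x) = shift (fst y)" "shift (- fst x) = shift (- fst y)"
    using shift_period[of "fst y" "2 * s"] shift_period[of "- fst y" "- 2 * s"] by (simp_all add: * algebra_simps)
  then show "act_b x \<doteq> act_b y" "act_b_inv x \<doteq> act_b_inv y"
    by (auto simp: act_b_def act_b_inv_def pair_cong_def *)
qed

lemma act_b_closed: "act_b \<in> carrier (perm_group (\<doteq>))"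
proof -
  have "bij act_b"
    by (rule o_bij[of act_b_inv]) (auto simp: act_b_inverse)
  then show ?thesis
    using act_b_cong act_b_inv_cong act_b_inverse by (metis perm_group_simps(3))
qed

text \<open>By \<open>shift_uminus\<close> the two shifts involved are equal for even
  \<open>i\<close> and add up to \<open>2 * k + l\<close> for odd \<open>i\<close>. Modulo
  \<open>4 * h\<close> only the \<open>l\<close> survives, as the relation for \<open>b^2 a\<close>
  demands.\<close>

lemma act_b_act_b:
  "act_b (act_b (i, j)) \<doteq> (if even i then (i, j + 2) else (i + 2 * h * l, j - 2 + 2 * h * l))"
proof -
  have s: "shift (2 * h * shift i - i) = shift (- i)"
    using shift_period[of "- i" "shift i"] by simp
  show ?thesis
  proof (cases "even i")
    case True
    then have "act_b (act_b (i, j)) = (i, j + 2 + 4 * h * shift i)"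
      by (simp add: act_b_def s shift_uminus even_2h)
    then show ?thesis
      using True by (simp add: pair_cong_def)
  next
    case False
    then have "act_b (act_b (i, j)) = (i + 2 * h * l + 4 * h * (k - shift i), j - 2 + 2 * h * l + 4 * h * k)"
      by (simp add: act_b_def s shift_uminus even_2h) (simp add: algebra_simps)
    then show ?thesis
      using False by (simp add: pair_cong_def)
  qed
qed

lemma cong_trans: "x \<doteq> y \<Longrightarrow> y \<doteq> w \<Longrightarrow> x \<doteq> w"
  and cong_refl: "x \<doteq> x"
  using equivp_pair_cong equivp_transp equivp_reflp by metis+

lemma funpow_act_a: "(act_a ^^ n) x = (fst x + int n, snd x)"
  by (induction n) (auto simp: act_a_def)

text \<open>The shift vanishes at first exponent 0, so \<open>act_b\<close> merely counts there;
  this orbit later separates the powers of \<open>b\<close>.\<close>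

lemma funpow_act_b_origin: "(act_b ^^ n) (0, 0) \<doteq> (0, int n)"
proof (induction n)
  case (Suc n)
  have "act_b (0, int n) = (0, int (Suc n))"
    by (simp add: act_b_def shift_def)
  then show ?case
    using act_b_cong[OF Suc] by simp
qed (simp add: cong_refl)

lemma funpow_act_b_even:
  "(act_b ^^ (2 * n)) (i, j) \<doteq>
    (if even i then (i, j + 2 * int n) else (i + 2 * h * l * int n, j - 2 * int n + 2 * h * l * int n))"
proof (induction n)
  case (Suc n)
  let ?y = "\<lambda>n. if even i then (i, j + 2 * int n)
    else (i + 2 * h * l * int n, j - 2 * int n + 2 * h * l * int n)"
  have "act_b (act_b ((act_b ^^ (2 * n)) (i, j))) \<doteq> act_b (act_b (?y n))"
    using Suc by (intro act_b_cong)
  moreover have "act_b (act_b (?y n)) \<doteq> ?y (Suc n)"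
  proof (cases "even i")
    case True
    have "j + 2 * int n + 2 = j + 2 * int (Suc n)"
      by simp
    then show ?thesis
      using act_b_act_b[of i "j + 2 * int n"] True by (simp only: if_True)
  next
    case False
    have "i + 2 * h * l * int n + 2 * h * l = i + 2 * h * l * int (Suc n)"
      "j - 2 * int n + 2 * h * l * int n - 2 + 2 * h * l = j - 2 * int (Suc n) + 2 * h * l * int (Suc n)"
      "even (i + 2 * h * l * int n) = even i"
      by (simp_all add: algebra_simps)
    then show ?thesis
      using act_b_act_b[of "i + 2 * h * l * int n" "j - 2 * int n + 2 * h * l * int n"] False
      by (simp only: if_False)
  qed
  moreover have "(act_b ^^ (2 * Suc n)) (i, j) = act_b (act_b ((act_b ^^ (2 * n)) (i, j)))"
    by simp
  ultimately show ?case
    using cong_trans by (simp only:)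
qed (simp add: cong_refl)

lemma even_lh: "even (l * h)"
  using odd_h by auto

text \<open>Multiplication by \<open>z^t\<close> on normal forms, written down directly so that
  relations involving it can be evaluated; \<open>Z_eq\<close> later identifies the case
  \<open>t = 1\<close> with \<open>a^(2h) b^(2h)\<close>.\<close>

definition act_z :: "int \<Rightarrow> int \<times> int \<Rightarrow> int \<times> int" where
  "act_z t x = (fst x + 2 * h * t, snd x + 2 * h * t)"

lemma act_z_closed: "act_z t \<in> carrier (perm_group (\<doteq>))"
proof -
  have "bij (act_z t)"
    by (rule o_bij[of "\<lambda>x. (fst x - 2 * h * t, snd x - 2 * h * t)"]) (auto simp: act_z_def)
  then show ?thesis
    by (simp add: act_z_def pair_cong_def)
qed

text \<open>For odd \<open>i\<close> the reversed direction is invisible because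
  \<open>- 2 * h\<close> and \<open>2 * h\<close> agree modulo \<open>4 * h\<close>, and the
  accumulated terms \<open>2 * h * l * h\<close> vanish because \<open>l * h\<close> is
  even.\<close>

lemma funpow_act_b_half: "(act_b ^^ (2 * nat h)) (i, j) \<doteq> (i, j + 2 * h)"
proof -
  obtain g where "l * h = 2 * g"
    using even_lh by (elim evenE)
  then have g: "2 * h * l * h = 4 * h * g"
    by (simp add: algebra_simps)
  have "(if even i then (i, j + 2 * h) else (i + 2 * h * l * h, j - 2 * h + 2 * h * l * h)) \<doteq> (i, j + 2 * h)"
    by (simp add: g pair_cong_def)
  moreover have "int (nat h) = h"
    using h_pos by simp
  ultimately show ?thesis
    using cong_trans[OF funpow_act_b_even[of "nat h" i j]] by (simp only:)
qed

definition model_coset :: "(int \<times> int \<Rightarrow> int \<times> int) \<Rightarrow> (int \<times> int \<Rightarrow> int \<times> int) set" where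
  "model_coset f = stabilizing_perms (\<doteq>) #>\<^bsub>perm_group (\<doteq>)\<^esub> f"

abbreviation "M \<equiv> perm_group (\<doteq>) Mod stabilizing_perms (\<doteq>)"

sublocale M: group M
  using normal.factorgroup_is_group[OF stabilizing_perms_normal[OF equivp_pair_cong]] .

sublocale coset: group_hom "perm_group (\<doteq>)" M model_coset
  using normal.r_coset_hom_Mod[OF stabilizing_perms_normal[OF equivp_pair_cong]]
    group_perm_group M.is_group
  by (auto simp: group_hom_def group_hom_axioms_def model_coset_def[abs_def])

lemma model_coset_eq:
  assumes "f \<in> carrier (perm_group (\<doteq>))" "g \<in> carrier (perm_group (\<doteq>))"
  shows "model_coset f = model_coset g \<longleftrightarrow> (\<forall>x. f x \<doteq> g x)"
  unfolding model_coset_def using assms by (rule stabilizing_perms_coset_eq[OF equivp_pair_cong])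

lemma model_coset_comp:
  assumes "f \<in> carrier (perm_group (\<doteq>))" "g \<in> carrier (perm_group (\<doteq>))"
  shows "model_coset f \<otimes>\<^bsub>M\<^esub> model_coset g = model_coset (f \<circ> g)"
  using coset.hom_mult[OF assms] by simp

lemma model_coset_pow:
  assumes "f \<in> carrier (perm_group (\<doteq>))"
  shows "model_coset f [^]\<^bsub>M\<^esub> n = model_coset (f ^^ n)"
  using coset.hom_nat_pow[OF assms, of n] by (simp only: pow_perm_group)

lemma funpow_closed:
  assumes "f \<in> carrier (perm_group (\<doteq>))"
  shows "f ^^ n \<in> carrier (perm_group (\<doteq>))"
  using monoid.nat_pow_closed[OF group.is_monoid[OF group_perm_group] assms, of n]
  by (simp only: pow_perm_group)

lemma id_closed: "id \<in> carrier (perm_group (\<doteq>))"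
  by simp

lemma comp_closed:
  assumes "f \<in> carrier (perm_group (\<doteq>))" "g \<in> carrier (perm_group (\<doteq>))"
  shows "f \<circ> g \<in> carrier (perm_group (\<doteq>))"
  using monoid.m_closed[OF group.is_monoid[OF group_perm_group] assms]
  by (simp only: perm_group_simps(1))

lemma perm_cong:
  assumes "f \<in> carrier (perm_group (\<doteq>))" "x \<doteq> y"
  shows "f x \<doteq> f y"
proof -
  have "\<forall>x y. f x \<doteq> f y \<longleftrightarrow> x \<doteq> y"
    using assms(1) unfolding perm_group_simps by (rule conjunct2)
  then show ?thesis
    using assms(2) by blast
qed

abbreviation "A \<equiv> model_coset act_a"
abbreviation "B \<equiv> model_coset act_b"
abbreviation "Z \<equiv> model_coset (act_z 1)"

lemmas act_closed = act_a_closed act_b_closed act_z_closed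

lemma act_z_pow:
  assumes "t \<in> {0, 1}"
  shows "Z [^]\<^bsub>M\<^esub> t = model_coset (act_z t)"
proof -
  have "act_z 0 = id"
    by (auto simp: act_z_def)
  then show ?thesis
    using assms coset.hom_one M.int_pow_1[OF coset.hom_closed[OF act_z_closed[of 1]]]
    by (elim insertE) (simp_all del: perm_group_simps(3))
qed

lemma A_closed: "A \<in> carrier M" and B_closed: "B \<in> carrier M"
  using coset.hom_closed act_closed by blast+

text \<open>With the multiples of \<open>4 * h\<close> given explicitly, each later comparison
  becomes a polynomial identity; the witnesses \<open>s\<close> and \<open>t\<close> are read off
  from the difference of the two sides.\<close>

lemma congI: "fst x = fst y + 4 * h * s \<Longrightarrow> snd x = snd y + 4 * h * t \<Longrightarrow> x \<doteq> y"
  by (simp add: pair_cong_def)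

lemma int_pow_M:
  assumes "f \<in> carrier (perm_group (\<doteq>))" "i \<ge> 0"
  shows "model_coset f [^]\<^bsub>M\<^esub> i = model_coset (f ^^ nat i)"
  using model_coset_pow[OF assms(1), of "nat i"] assms(2) by (metis int_nat_eq int_pow_int)

lemma A_pow: "A [^]\<^bsub>M\<^esub> (4 * h) = \<one>\<^bsub>M\<^esub>"
proof -
  have "model_coset (act_a ^^ nat (4 * h)) = model_coset id"
    using h_pos id_closed
    by (subst model_coset_eq) (auto simp: funpow_closed act_closed funpow_act_a pair_cong_def simp del: perm_group_simps(3))
  then show ?thesis
    using h_pos coset.hom_one by (simp add: int_pow_M act_closed del: perm_group_simps(3))
qed

lemma B_pow: "B [^]\<^bsub>M\<^esub> (4 * h) = \<one>\<^bsub>M\<^esub>"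
proof -
  have h: "nat (4 * h) = 2 * (2 * nat h)" "int (2 * nat h) = 2 * h"
    using h_pos by auto
  have "(act_b ^^ nat (4 * h)) (i, j) \<doteq> (i, j)" for i j
  proof -
    have "(if even i then (i, j + 2 * (2 * h))
        else (i + 2 * h * l * (2 * h), j - 2 * (2 * h) + 2 * h * l * (2 * h))) \<doteq> (i, j)"
      by (simp add: pair_cong_def)
    then show ?thesis
      unfolding h(1) using cong_trans[OF funpow_act_b_even[of "2 * nat h" i j]] by (simp only: h(2))
  qed
  then have "model_coset (act_b ^^ nat (4 * h)) = model_coset id"
    using id_closed
    by (subst model_coset_eq) (auto simp: funpow_closed act_closed simp del: perm_group_simps(3))
  then show ?thesis
    using h_pos coset.hom_one by (simp add: int_pow_M act_closed del: perm_group_simps(3))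
qed

lemma Z_eq: "Z = A [^]\<^bsub>M\<^esub> (2 * h) \<otimes>\<^bsub>M\<^esub> B [^]\<^bsub>M\<^esub> (2 * h)"
proof -
  have h: "nat (2 * h) = 2 * nat h" "int (2 * nat h) = 2 * h"
    using h_pos by auto
  have "(act_a ^^ (2 * nat h)) ((act_b ^^ (2 * nat h)) (i, j)) \<doteq> act_z 1 (i, j)" for i j
    using perm_cong[OF funpow_closed[OF act_a_closed] funpow_act_b_half, of "2 * nat h" i j] h
    by (simp add: funpow_act_a act_z_def)
  then have "model_coset (act_a ^^ (2 * nat h) \<circ> act_b ^^ (2 * nat h)) = Z"
    by (subst model_coset_eq) (auto simp: comp_closed funpow_closed act_closed simp del: perm_group_simps(3))
  then show ?thesis
    using h_pos by (simp only: int_pow_M act_closed h model_coset_comp funpow_closed)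
qed

lemma act_b_act_b_cong:
  "x \<doteq> (i, j) \<Longrightarrow> act_b (act_b x) \<doteq> (if even i then (i, j + 2) else (i + 2 * h * l, j - 2 + 2 * h * l))"
  using act_b_act_b[of i j] act_b_cong cong_trans by blast

lemma act_a_cong: "x \<doteq> y \<Longrightarrow> act_a x \<doteq> act_a y"
  using perm_cong[OF act_a_closed] .

lemma cong_sym: "x \<doteq> y \<Longrightarrow> y \<doteq> x"
  using equivp_pair_cong equivp_symp by metis

lemma shift_period1: "shift (i + 2 * h) = shift i"
  using shift_period[of i 1] by simp

lemma act_sq: "act_b (act_b (act_a (act_a (i, j)))) \<doteq> act_a (act_a (act_b (act_b (i, j))))"
proof -
  let ?y = "if even i then (i, j + 2) else (i + 2 * h * l, j - 2 + 2 * h * l)"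
  have aa: "act_a (act_a x) = (fst x + 2, snd x)" for x
    by (simp add: act_a_def)
  have "act_b (act_b (i + 2, j)) \<doteq> act_a (act_a ?y)"
    using act_b_act_b[of "i + 2" j] by (cases "even i") (simp_all add: aa algebra_simps)
  from cong_trans[OF this cong_sym[OF act_a_cong[OF act_a_cong[OF act_b_act_b]]]]
  show ?thesis
    unfolding aa[of "(i, j)"] by simp
qed

lemma act_ba: "act_b (act_a (act_b (act_b (i, j)))) \<doteq> act_a (act_b (act_a (act_a (act_z k (i, j)))))"
proof -
  define s where "s = shift i"
  have sh: "shift (i + 1) = (if even i then k + l - s else s - k)"
    "shift (i + 2) = (if even i then l else 2 * k + l) - s"
    by (simp_all add: s_def shift_add_1 shift_add_2)
  have "act_b (act_a (act_b (act_b (i, j)))) \<doteq>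
      act_b (act_a (if even i then (i, j + 2) else (i + 2 * h * l, j - 2 + 2 * h * l)))"
    by (intro act_b_cong act_a_cong act_b_act_b)
  moreover have "\<dots> \<doteq> act_a (act_b (act_a (act_a (act_z k (i, j)))))"
  proof (cases "even i")
    case True
    have "shift (i + 2 * h * k + 1 + 1) = shift (i + 2)"
      using shift_period[of "i + 2" k] by (simp add: algebra_simps)
    with True show ?thesis
      by (intro congI[where s = k and t = 0])
        (simp_all add: act_a_def act_b_def act_z_def even_2h sh, simp_all add: algebra_simps)
  next
    case False
    have "shift (i + 2 * h * k + 1 + 1) = shift (i + 2)" "shift (i + 2 * h * l + 1) = shift (i + 1)"
      using shift_period[of "i + 2" k] shift_period[of "i + 1" l] by (simp_all add: algebra_simps)
    with False show ?thesis
      by (intro congI[where s = "s - k - l" and t = "s - 2 * k"])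
        (simp_all add: act_a_def act_b_def act_z_def even_2h sh, simp_all add: algebra_simps)
  qed
  ultimately show ?thesis
    using cong_trans by blast
qed

lemma act_b2a: "act_b (act_b (act_a (act_b (act_b (i, j))))) \<doteq> act_a (act_z l (i, j))"
proof -
  let ?y = "if even i then (i, j + 2) else (i + 2 * h * l, j - 2 + 2 * h * l)"
  have "act_a (act_b (act_b (i, j))) \<doteq> (fst (act_a ?y), snd (act_a ?y))"
    using act_a_cong[OF act_b_act_b[of i j]] by simp
  from act_b_act_b_cong[OF this] show ?thesis
    by (auto simp: act_a_def act_z_def even_2h algebra_simps split: if_splits)
qed

lemma act_a2b: "act_a (act_a (act_b (act_a (act_a (i, j))))) \<doteq> act_b (act_z l (i, j))"
proof -
  define s where "s = shift i"
  have sh: "shift (i + 2) = (if even i then l else 2 * k + l) - s"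
    "shift (i + 1 + 1) = (if even i then l else 2 * k + l) - s"
    by (simp_all only: s_def shift_add_2 add.assoc one_add_one)
  have "shift (i + 2 * h * l) = s"
    unfolding s_def by (rule shift_period)
  then show ?thesis
    by (cases "even i"; intro congI[where s = "l - s + (if even i then 0 else k)" and t = "(if even i then 0 else k) - s"])
      (simp_all add: act_a_def act_b_def act_z_def even_2h sh, simp_all add: sh algebra_simps)
qed

lemma act_za: "act_z 1 (act_a x) = act_a (act_z 1 x)"
  by (simp add: act_a_def act_z_def)

lemma act_zb: "act_z 1 (act_b (i, j)) \<doteq> act_b (act_z 1 (i, j))"
  by (intro congI[where s = 1 and t = 0])
    (simp_all add: act_b_def act_z_def shift_period1)

lemma satisfies_relations: "G2_relations M h k l A B Z"
proof (rule M.G2_relationsI[OF h_pos k l odd_h A_closed B_closed Z_eq A_pow B_pow])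
  note simps = model_coset_comp act_closed comp_closed act_z_pow[OF k] act_z_pow[OF l]
  note eqI = model_coset_eq[THEN iffD2, OF _ _ allI]
  show "Z \<otimes>\<^bsub>M\<^esub> A = A \<otimes>\<^bsub>M\<^esub> Z"
    by (simp only: simps, rule eqI) (auto simp: comp_closed act_closed act_za cong_refl simp del: perm_group_simps(3))
  show "Z \<otimes>\<^bsub>M\<^esub> B = B \<otimes>\<^bsub>M\<^esub> Z"
    by (simp only: simps, rule eqI) (auto simp: comp_closed act_closed act_zb simp del: perm_group_simps(3))
  show "B \<otimes>\<^bsub>M\<^esub> B \<otimes>\<^bsub>M\<^esub> A \<otimes>\<^bsub>M\<^esub> A = A \<otimes>\<^bsub>M\<^esub> A \<otimes>\<^bsub>M\<^esub> B \<otimes>\<^bsub>M\<^esub> B"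
    by (simp only: simps, rule eqI) (auto simp: comp_closed act_closed act_sq simp del: perm_group_simps(3))
  show "B \<otimes>\<^bsub>M\<^esub> A \<otimes>\<^bsub>M\<^esub> B \<otimes>\<^bsub>M\<^esub> B = A \<otimes>\<^bsub>M\<^esub> B \<otimes>\<^bsub>M\<^esub> A \<otimes>\<^bsub>M\<^esub> A \<otimes>\<^bsub>M\<^esub> Z [^]\<^bsub>M\<^esub> k"
    by (simp only: simps, rule eqI) (auto simp: comp_closed act_closed act_ba simp del: perm_group_simps(3))
  show "B \<otimes>\<^bsub>M\<^esub> B \<otimes>\<^bsub>M\<^esub> A \<otimes>\<^bsub>M\<^esub> B \<otimes>\<^bsub>M\<^esub> B = A \<otimes>\<^bsub>M\<^esub> Z [^]\<^bsub>M\<^esub> l"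
    by (simp only: simps, rule eqI) (auto simp: comp_closed act_closed act_b2a simp del: perm_group_simps(3))
  show "A \<otimes>\<^bsub>M\<^esub> A \<otimes>\<^bsub>M\<^esub> B \<otimes>\<^bsub>M\<^esub> A \<otimes>\<^bsub>M\<^esub> A = B \<otimes>\<^bsub>M\<^esub> Z [^]\<^bsub>M\<^esub> l"
    by (simp only: simps, rule eqI) (auto simp: comp_closed act_closed act_a2b simp del: perm_group_simps(3))
qed

text \<open>Once the exponents are reduced to natural numbers \<open>p\<close> and \<open>q\<close>,
  powers are iterates. The permutation for \<open>a^p b^q\<close> sends (0, 0) to (p, q) up to
  congruence, whereas the identity fixes (0, 0).\<close>

lemma independent:
  fixes i j :: int
  assumes "A [^]\<^bsub>M\<^esub> i \<otimes>\<^bsub>M\<^esub> B [^]\<^bsub>M\<^esub> j = \<one>\<^bsub>M\<^esub>"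
  shows "4 * h dvd i \<and> 4 * h dvd j"
proof -
  interpret rel: G2_relations M h k l A B Z
    by (rule satisfies_relations)
  define p where "p = nat (i mod (4 * h))"
  define q where "q = nat (j mod (4 * h))"
  have pq: "int p = i mod (4 * h)" "int q = j mod (4 * h)"
    using h_pos by (simp_all add: p_def q_def)
  have dvd: "4 * h dvd i - int p" "4 * h dvd j - int q"
    by (simp_all add: pq dvd_minus_mod)
  have "A [^]\<^bsub>M\<^esub> i = A [^]\<^bsub>M\<^esub> p" "B [^]\<^bsub>M\<^esub> j = B [^]\<^bsub>M\<^esub> q"
    using rel.a_cong[OF dvd(1)] rel.b_cong[OF dvd(2)] by (simp_all add: int_pow_int)
  then have "model_coset (act_a ^^ p \<circ> act_b ^^ q) = model_coset id"
    using assms coset.hom_one by (simp only: model_coset_pow model_coset_comp act_closed funpow_closed perm_group_simps(2))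
  then have "(act_a ^^ p \<circ> act_b ^^ q) (0, 0) \<doteq> id (0, 0)"
    using id_closed
    by (subst (asm) model_coset_eq) (auto simp: comp_closed funpow_closed act_closed simp del: perm_group_simps(3))
  then have "(act_a ^^ p) ((act_b ^^ q) (0, 0)) \<doteq> (0, 0)"
    by simp
  moreover have "(act_a ^^ p) ((act_b ^^ q) (0, 0)) \<doteq> (act_a ^^ p) (0, int q)"
    by (rule perm_cong[OF funpow_closed[OF act_a_closed] funpow_act_b_origin])
  moreover have "(act_a ^^ p) (0, int q) = (int p, int q)"
    by (simp add: funpow_act_a)
  ultimately have "(int p, int q) \<doteq> (0, 0)"
    by (metis cong_trans cong_sym)
  then show ?thesis
    using pq by (simp add: pair_cong_def dvd_eq_mod_eq_0)
qed

end

section \<open>Normal forms and element orders\<close>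

lemma (in group) commute_generate:
  assumes "x \<in> carrier G" "S \<subseteq> carrier G" "\<And>s. s \<in> S \<Longrightarrow> x \<otimes> s = s \<otimes> x" "y \<in> generate G S"
  shows "x \<otimes> y = y \<otimes> x"
  using assms(4)
proof (induction rule: generate.induct)
  case (inv s)
  then have "s \<in> carrier G"
    using assms(2) by blast
  then have "inv s \<otimes> (x \<otimes> s) \<otimes> inv s = inv s \<otimes> (s \<otimes> x) \<otimes> inv s"
    using assms(3)[OF inv] by simp
  then show ?case
    using \<open>s \<in> carrier G\<close> assms(1) by (simp add: m_assoc)
next
  case (eng y y')
  then have "y \<in> carrier G" "y' \<in> carrier G"
    using generate_in_carrier[OF assms(2)] by blast+
  then show ?case
    using eng assms(1) by (metis m_assoc)
qed (use assms in auto)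

lemma (in group) ord_eq_2I:
  assumes "x \<in> carrier G" "x [^] (2::int) = \<one>" "x \<noteq> \<one>"
  shows "ord x = 2"
proof -
  have "ord x dvd 2"
    using assms int_pow_eq_id[of x 2] int_dvd_int_iff[of "ord x" 2] by simp
  then show ?thesis
    using assms ord_eq_1 by (metis prime_nat_iff two_is_prime_nat)
qed

lemma (in group) ord_eq_two_powerI:
  assumes "x \<in> carrier G" "x [^] (2 ^ Suc d :: nat) = \<one>" "x [^] (2 ^ d :: nat) \<noteq> \<one>"
  shows "ord x = 2 ^ Suc d"
proof -
  have "ord x dvd 2 ^ Suc d"
    using assms pow_eq_id by blast
  then obtain r where r: "r \<le> Suc d" "ord x = 2 ^ r"
    using divides_primepow_nat[OF two_is_prime_nat] by blast
  have "\<not> r \<le> d"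
    using assms(1,3) pow_eq_id r(2) le_imp_power_dvd by metis
  then show ?thesis
    using r by (simp add: le_Suc_eq)
qed

lemma (in normal) conj_mem_iff:
  assumes "g \<in> carrier G" "y \<in> carrier G"
  shows "g \<otimes> y \<otimes> inv g \<in> H \<longleftrightarrow> y \<in> H"
proof
  assume "g \<otimes> y \<otimes> inv g \<in> H"
  then have "inv g \<otimes> (g \<otimes> y \<otimes> inv g) \<otimes> g \<in> H"
    using assms inv_op_closed1 by blast
  then show "y \<in> H"
    using assms by (simp add: m_assoc)
qed (use assms inv_op_closed2 in auto)

lemma (in group) iso_integer_mod_group:
  assumes u: "u \<in> carrier G" and "ord u = m" "m > 0"
  shows "subgroup_generated G {u} \<cong> integer_mod_group m"
proof -
  interpret H: group "subgroup_generated G {u}"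
    by simp
  have mod: "u [^] (i mod int m) = u [^] i" for i
    using u assms(2) by (simp add: int_pow_eq dvd_eq_mod_eq_0 mod_diff_right_eq)
  have "(\<lambda>i. u [^] i) \<in> iso (integer_mod_group m) (subgroup_generated G {u})"
  proof (rule isoI)
    show "(\<lambda>i. u [^] i) \<in> hom (integer_mod_group m) (subgroup_generated G {u})"
      using u by (intro homI) (auto simp: mod int_pow_mult carrier_subgroup_generated_by_singleton)
    show "bij_betw (\<lambda>i. u [^] i) (carrier (integer_mod_group m)) (carrier (subgroup_generated G {u}))"
    proof (rule bij_betw_imageI)
      show "inj_on (\<lambda>i. u [^] i) (carrier (integer_mod_group m))"
      proof (rule inj_onI)
        fix i j
        assume ij: "i \<in> carrier (integer_mod_group m)" "j \<in> carrier (integer_mod_group m)"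
          and "u [^] i = u [^] j"
        then have "i mod int m = j mod int m"
          using u assms(2) by (simp add: int_pow_eq mod_eq_dvd_iff dvd_diff_commute)
        then show "i = j"
          using ij assms(3) by (simp add: carrier_integer_mod_group)
      qed
      show "(\<lambda>i. u [^] i) ` carrier (integer_mod_group m) = carrier (subgroup_generated G {u})"
      proof (intro equalityI subsetI)
        fix y
        assume "y \<in> carrier (subgroup_generated G {u})"
        then obtain i :: int where "y = u [^] i"
          using u by (auto simp: carrier_subgroup_generated_by_singleton)
        then have "y = u [^] (i mod int m)" "i mod int m \<in> carrier (integer_mod_group m)"
          using mod assms(3) by (auto simp: carrier_integer_mod_group)
        then show "y \<in> (\<lambda>i. u [^] i) ` carrier (integer_mod_group m)"
          by blast
      qed (use u in \<open>auto simp: carrier_subgroup_generated_by_singleton\<close>)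
    qed
  qed
  then show ?thesis
    using group.iso_sym[OF group_integer_mod_group] is_isoI by blast
qed

text \<open>\<open>independent\<close> is the lower bound that the model supplies;
  \<open>G2_group_G2\<close> discharges it. With \<open>h\<close> a power of 2, an element order can
  be read off from a single power.\<close>

locale G2_group = G2_relations +
  assumes gen: "generate G {a, b} = carrier G"
    and independent: "a [^] i \<otimes> b [^] j = \<one> \<Longrightarrow> 4 * h dvd i \<and> 4 * h dvd j"
    and h_power: "\<exists>d. h = 2 ^ d"
begin

definition nf :: "int \<Rightarrow> int \<Rightarrow> 'a" where
  "nf i j = a [^] i \<otimes> b [^] j"

lemma nf_closed [simp, intro]: "nf i j \<in> carrier G"
  by (simp add: nf_def)

lemma nf_0 [simp]: "nf 0 0 = \<one>" and a_pow_nf: "a [^] i = nf i 0" and b_pow_nf: "b [^] j = nf 0 j"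
  and z_pow_nf: "z [^] t = nf (2 * h * t) (2 * h * t)"
  by (simp_all add: nf_def z_pow)

lemma nf_z: "nf i j \<otimes> z [^] (t::int) = nf (i + 2 * h * t) (j + 2 * h * t)"
proof -
  have "nf i j \<otimes> z [^] t = a [^] i \<otimes> (b [^] j \<otimes> a [^] (2 * h * t)) \<otimes> b [^] (2 * h * t)"
    by (simp add: nf_def z_pow m_assoc)
  also have "b [^] j \<otimes> a [^] (2 * h * t) = a [^] (2 * h * t) \<otimes> b [^] j"
    using int_pow_commute[OF a_half_b, of t j] by (simp add: int_pow_pow)
  finally show ?thesis
    by (simp add: nf_def collect)
qed

lemma nf_mult:
  "nf i j \<otimes> nf p q =
     nf (i + (if even j then p else - p) + 2 * h * twist p j)
       ((if even p then j else - j) + q + 2 * h * twist p j)"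
proof -
  have "nf i j \<otimes> nf p q = a [^] i \<otimes> (b [^] j \<otimes> a [^] p) \<otimes> b [^] q"
    by (simp add: nf_def m_assoc)
  also have "\<dots> = nf (i + (if even j then p else - p)) ((if even p then j else - j) + q) \<otimes> z [^] twist p j"
    unfolding b_pow_a_pow by (simp add: nf_def collect)
  finally show ?thesis
    by (simp only: nf_z)
qed

lemma nf_eq_iff: "nf i j = nf p q \<longleftrightarrow> 4 * h dvd i - p \<and> 4 * h dvd j - q"
proof
  assume eq: "nf i j = nf p q"
  have "a [^] (i - p) \<otimes> b [^] (j - q) = a [^] (- p) \<otimes> nf i j \<otimes> b [^] (- q)"
    by (simp add: nf_def collect)
  also have "\<dots> = \<one>"
    unfolding eq by (simp add: nf_def collect)
  finally show "4 * h dvd i - p \<and> 4 * h dvd j - q"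
    by (rule independent)
next
  assume "4 * h dvd i - p \<and> 4 * h dvd j - q"
  then show "nf i j = nf p q"
    using a_cong[of i p] b_cong[of j q] by (simp add: nf_def)
qed

lemma nf_eq_one_iff: "nf i j = \<one> \<longleftrightarrow> 4 * h dvd i \<and> 4 * h dvd j"
  using nf_eq_iff[of i j 0 0] by simp

lemma carrier_nf: "x \<in> carrier G \<longleftrightarrow> (\<exists>i j. x = nf i j)"
proof
  assume "x \<in> carrier G"
  then have "x \<in> generate G {a, b}"
    by (simp add: gen)
  then show "\<exists>i j. x = nf i j"
  proof (induction rule: generate.induct)
    case one
    then show ?case
      by (metis nf_0)
  next
    case (incl x)
    then show ?case
      using a_pow_nf[of 1] b_pow_nf[of 1] by auto
  next
    case (inv x)
    then show ?case
      using a_pow_nf[of "- 1"] b_pow_nf[of "- 1"] by (auto simp: int_pow_neg)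
  next
    case (eng x y)
    then show ?case
      by (metis nf_mult)
  qed
qed auto

lemma center_iff: "x \<in> group_center G \<longleftrightarrow> x \<in> carrier G \<and> x \<otimes> a = a \<otimes> x \<and> x \<otimes> b = b \<otimes> x"
  using commute_generate[of x "{a, b}"] by (auto simp: group_center_def gen)

lemma dvd_2h: "\<not> 4 * h dvd 2 * h"
  using h_pos zdvd_imp_le by force

lemma central_involutions:
  assumes "x \<in> {a [^] (2 * h), b [^] (2 * h), z}"
  shows "x \<in> group_center G" "ord x = 2"
proof -
  have "a [^] (2 * h) \<otimes> a = a \<otimes> a [^] (2 * h)" "b [^] (2 * h) \<otimes> b = b \<otimes> b [^] (2 * h)"
    by (simp_all add: int_pow_commute_left)
  then show "x \<in> group_center G"
    using assms a_half_b b_half_a z_a z_b by (auto simp: center_iff)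
  have "z = nf (2 * h) (2 * h)"
    by (simp add: nf_def z_def)
  then have "x \<noteq> \<one>"
    using assms nf_eq_one_iff[of "2 * h" 0] nf_eq_one_iff[of 0 "2 * h"] nf_eq_one_iff[of "2 * h" "2 * h"] dvd_2h
    by (auto simp: a_pow_nf b_pow_nf)
  moreover have "x [^] (2::int) = \<one>"
    using assms z_sq rel_a rel_b by (auto simp: int_pow_pow mult.commute)
  moreover have "x \<in> carrier G"
    using assms by auto
  ultimately show "ord x = 2"
    using ord_eq_2I by blast
qed

lemma nf_int_pow_even:
  assumes "even i" "even j"
  shows "nf i j [^] (t::int) = nf (i * t) (j * t)"
  unfolding nf_def using assms
  by (subst int_pow_mult_distrib) (simp_all add: even_commute int_pow_pow)

text \<open>Squares have even exponents, and there powers are computed coordinatewise; even powers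
  of any element are therefore accessible through its square.\<close>

lemma nf_sq: "nf i j [^] (2::int) =
    (if even i then if even j then nf (2 * i) (2 * j) else nf (2 * h * twist i j) (2 * j + 2 * h * twist i j)
     else if even j then nf (2 * i + 2 * h * twist i j) (2 * h * twist i j)
     else nf (2 * h * twist i j) (2 * h * twist i j))"
proof -
  have "nf i j [^] (2::int) = nf i j \<otimes> nf i j"
    using int_pow_mult[of "nf i j" 1 1] by simp
  then show ?thesis
    by (simp add: nf_mult twist_def)
qed

text \<open>The power is taken as the \<open>h\<close>-th power of the square. Unless both exponents
  are odd, \<open>twist i j\<close> is a multiple of \<open>l\<close>, so its contribution dies
  because \<open>l * h\<close> is even; the odd exponent contributes \<open>2 * h\<close> modulo
  \<open>4 * h\<close>.\<close>

lemma nf_pow_half: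
  "odd i \<Longrightarrow> even j \<Longrightarrow> nf i j [^] (2 * h) = a [^] (2 * h)"
  "even i \<Longrightarrow> odd j \<Longrightarrow> nf i j [^] (2 * h) = b [^] (2 * h)"
proof -
  have *: "nf i j [^] (2 * h) = (nf i j [^] (2::int)) [^] h"
    by (simp add: int_pow_pow)
  have tw: "even (twist i j * h)" if "\<not> (odd i \<and> odd j)"
    using that even_lh by (auto simp: twist_def)
  have z_part: "4 * h dvd 2 * h * x * h" if x: "even (x * h)" for x
  proof -
    obtain c where c: "x * h = 2 * c"
      using x by (elim evenE)
    have "2 * h * x * h = 2 * h * (x * h)"
      by (simp only: mult.assoc)
    also have "\<dots> = 4 * h * c"
      unfolding c by simp
    finally show ?thesis
      by (metis dvd_triv_left)
  qed
  have main_part: "4 * h dvd (2 * p + 2 * h * x) * h - 2 * h" if p: "odd p" and x: "even (x * h)" for p x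
  proof -
    obtain c where "p = 2 * c + 1"
      using p by (elim oddE)
    then have "(2 * p + 2 * h * x) * h - 2 * h = 4 * h * c + 2 * h * x * h"
      by (simp add: algebra_simps)
    then show ?thesis
      using z_part[OF x] by simp
  qed
  show "nf i j [^] (2 * h) = a [^] (2 * h)" if "odd i" "even j"
    unfolding * using that main_part[of i "twist i j"] z_part[of "twist i j"] tw
    by (simp add: nf_sq nf_int_pow_even a_pow_nf nf_eq_iff)
  show "nf i j [^] (2 * h) = b [^] (2 * h)" if "even i" "odd j"
    unfolding * using that main_part[of j "twist i j"] z_part[of "twist i j"] tw
    by (simp add: nf_sq nf_int_pow_even b_pow_nf nf_eq_iff)
qed

text \<open>The power \<open>2 * h\<close> is a central involution, so it is nontrivial with trivial
  square; since \<open>4 * h\<close> is a power of 2, this fixes the order.\<close>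

lemma ord_nf:
  assumes "odd i \<longleftrightarrow> even j"
  shows "ord (nf i j) = nat (4 * h)"
proof -
  obtain d where d: "h = 2 ^ d"
    using h_power by blast
  have "(nf i j [^] (2 * h)) [^] (2::int) = nf i j [^] (4 * h)"
  proof -
    have "2 * h * 2 = 4 * h"
      by simp
    then show ?thesis
      by (simp only: int_pow_pow nf_closed)
  qed
  then have *: "nf i j [^] (2 ^ Suc d :: nat) = nf i j [^] (2 * h)"
    "nf i j [^] (2 ^ Suc (Suc d) :: nat) = (nf i j [^] (2 * h)) [^] (2::int)"
    using int_pow_int[of G "nf i j" "2 ^ Suc d"] int_pow_int[of G "nf i j" "2 ^ Suc (Suc d)"]
    by (simp_all add: d)
  have x: "nf i j [^] (2 * h) \<in> {a [^] (2 * h), b [^] (2 * h), z}"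
    using assms nf_pow_half by (cases "odd i") auto
  have "nf i j [^] (2 * h) \<noteq> \<one>" "(nf i j [^] (2 * h)) [^] (2::int) = \<one>"
    using central_involutions(2)[OF x] ord_eq_1[of "nf i j [^] (2 * h)"]
      int_pow_eq_id[of "nf i j [^] (2 * h)" 2] by auto
  then have "ord (nf i j) = 2 ^ Suc (Suc d)"
    by (intro ord_eq_two_powerI) (simp_all only: * nf_closed not_False_eq_True)
  then show ?thesis
    by (simp add: d nat_mult_distrib nat_power_eq)
qed

lemma ord_nf_even:
  assumes "even i" "even j"
  shows "ord (nf i j) dvd nat (2 * h)"
proof -
  have "nf i j [^] (2 * h) = \<one>"
    using assms by (auto simp: nf_int_pow_even nf_eq_one_iff elim!: evenE)
  then show ?thesis
    using int_pow_eq_id[of "nf i j" "2 * h"] h_pos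
      int_dvd_int_iff[of "ord (nf i j)" "nat (2 * h)"] by simp
qed

text \<open>For two odd exponents the original exponents cancel in the square, leaving a power of
  \<open>z\<close>, which is trivial if k = l = 0.\<close>

lemma ord_nf_odd:
  assumes "odd i" "odd j"
  shows "ord (nf i j) dvd 4" "k = 0 \<Longrightarrow> l = 0 \<Longrightarrow> ord (nf i j) = 2"
proof -
  have sq: "nf i j [^] (2::int) = z [^] twist i j"
    using assms by (simp add: nf_sq z_pow_nf)
  have "nf i j [^] (4::int) = (nf i j [^] (2::int)) [^] (2::int)"
    by (simp add: int_pow_pow)
  also have "\<dots> = (z [^] (2::int)) [^] twist i j"
    by (simp add: sq int_pow_pow mult.commute)
  finally have "nf i j [^] (4::int) = \<one>"
    by (simp add: z_sq)
  then show "ord (nf i j) dvd 4"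
    using int_pow_eq_id[of "nf i j" 4] int_dvd_int_iff[of "ord (nf i j)" 4] by simp
  have "nf i j \<noteq> \<one>"
    using assms by (auto simp: nf_eq_one_iff)
  then show "ord (nf i j) = 2" if "k = 0" "l = 0"
  proof -
    have "twist i j = 0"
      using that assms unfolding twist_def by simp
    then show ?thesis
      using \<open>nf i j \<noteq> \<one>\<close> sq by (intro ord_eq_2I) simp_all
  qed
qed

lemma factorization:
  "carrier G = generate G {a} <#> generate G {b}"
  "ord a = nat (4 * h)" "ord b = nat (4 * h)"
  "generate G {a} \<inter> generate G {b} = {\<one>}"
proof -
  have gen_ab: "generate G {a} = {a [^] i |i. i \<in> (UNIV :: int set)}"
    "generate G {b} = {b [^] i |i. i \<in> (UNIV :: int set)}"
    by (simp_all add: generate_pow)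
  show "carrier G = generate G {a} <#> generate G {b}"
    unfolding gen_ab by (auto simp: carrier_nf set_mult_def nf_def) blast
  show "ord a = nat (4 * h)" "ord b = nat (4 * h)"
    using ord_nf[of 1 0] ord_nf[of 0 1] by (simp_all add: nf_def)
  have "x = \<one>" if "x = a [^] i" "x = b [^] j" for x and i j :: int
    using that nf_eq_iff[of i 0 0 j] nf_eq_one_iff[of i 0] by (simp add: a_pow_nf b_pow_nf)
  then show "generate G {a} \<inter> generate G {b} = {\<one>}"
    using generate.one[of G "{a}"] generate.one[of G "{b}"] unfolding gen_ab by blast
qed

end

section \<open>The derived subgroup and metacyclicity\<close>

lemma (in group) normal_if_generators:
  assumes N: "subgroup N G" and S: "S \<subseteq> carrier G" "generate G S = carrier G"
    and conj: "\<And>s y. s \<in> S \<Longrightarrow> y \<in> N \<Longrightarrow> s \<otimes> y \<otimes> inv s \<in> N \<and> inv s \<otimes> y \<otimes> s \<in> N"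
  shows "N \<lhd> G"
proof (rule normal_invI[OF N])
  fix g y
  assume "g \<in> carrier G" "y \<in> N"
  then have "g \<in> generate G S"
    using S by simp
  then show "g \<otimes> y \<otimes> inv g \<in> N"
    using \<open>y \<in> N\<close>
  proof (induction arbitrary: y rule: generate.induct)
    case one
    then show ?case
      using subgroup.mem_carrier[OF N] by simp
  next
    case (inv s)
    moreover have "s \<in> carrier G"
      using S inv by blast
    ultimately show ?case
      using conj by simp
  next
    case (eng g g')
    have c: "g \<in> carrier G" "g' \<in> carrier G" "y \<in> carrier G"
      using eng generate_in_carrier[OF S(1)] subgroup.mem_carrier[OF N] by blast+
    then have "g \<otimes> g' \<otimes> y \<otimes> inv (g \<otimes> g') = g \<otimes> (g' \<otimes> y \<otimes> inv g') \<otimes> inv g"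
      by (simp add: m_assoc inv_mult_group)
    then show ?case
      using eng by simp
  qed (use conj in blast)
qed

lemma (in group) commuting_generators:
  assumes "S \<subseteq> carrier G" "generate G S = carrier G"
    and "\<And>s t. s \<in> S \<Longrightarrow> t \<in> S \<Longrightarrow> s \<otimes> t = t \<otimes> s"
    and "x \<in> carrier G" "y \<in> carrier G"
  shows "x \<otimes> y = y \<otimes> x"
proof (rule commute_generate[OF assms(4,1)])
  show "x \<otimes> s = s \<otimes> x" if "s \<in> S" for s
    using commute_generate[of s S x] assms that by auto
qed (use assms in auto)

context normal
begin

lemma coset_group_hom: "group_hom G (G Mod H) (\<lambda>x. H #> x)"
  using is_group factorgroup_is_group r_coset_hom_Mod by (simp add: group_hom_def group_hom_axioms_def)

lemma coset_commute_iff: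
  assumes "x \<in> carrier G" "y \<in> carrier G"
  shows "(H #> x) \<otimes>\<^bsub>G Mod H\<^esub> (H #> y) = (H #> y) \<otimes>\<^bsub>G Mod H\<^esub> (H #> x) \<longleftrightarrow>
    x \<otimes> y \<otimes> inv (y \<otimes> x) \<in> H"
  using assms r_coset_eq_iff[OF subgroup_axioms, of "x \<otimes> y" "y \<otimes> x"] by (simp add: rcos_sum)

lemma derived_subset_iff:
  "derived G (carrier G) \<subseteq> H \<longleftrightarrow> (\<forall>x \<in> carrier G. \<forall>y \<in> carrier G. x \<otimes> y \<otimes> inv (y \<otimes> x) \<in> H)"
proof -
  have eq: "x \<otimes> y \<otimes> inv x \<otimes> inv y = x \<otimes> y \<otimes> inv (y \<otimes> x)" if "x \<in> carrier G" "y \<in> carrier G" for x y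
    using that by (simp add: m_assoc inv_mult_group)
  have sub: "derived_set G (carrier G) \<subseteq> derived G (carrier G)"
    unfolding derived_def by (rule subsetI) (rule generate.incl)
  have incl: "derived_set G (carrier G) \<subseteq> H \<Longrightarrow> derived G (carrier G) \<subseteq> H"
    unfolding derived_def by (rule generate_subgroup_incl[OF _ subgroup_axioms])
  have "derived G (carrier G) \<subseteq> H \<longleftrightarrow> derived_set G (carrier G) \<subseteq> H"
    by (rule iffI[OF subset_trans[OF sub] incl])
  also have "\<dots> \<longleftrightarrow> (\<forall>x \<in> carrier G. \<forall>y \<in> carrier G. x \<otimes> y \<otimes> inv x \<otimes> inv y \<in> H)"
    by (simp add: UN_subset_iff)
  finally show ?thesis
    by (simp add: eq)
qed

text \<open>The images of the two generators generate the quotient and commute, so the quotient is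
  abelian.\<close>

lemma derived_subset_if_generators:
  assumes "generate G {a, b} = carrier G" "a \<in> carrier G" "b \<in> carrier G"
    and "b \<otimes> a \<otimes> inv (a \<otimes> b) \<in> H"
  shows "derived G (carrier G) \<subseteq> H"
  unfolding derived_subset_iff
proof (intro ballI)
  interpret q: group_hom G "G Mod H" "\<lambda>x. H #> x"
    by (rule coset_group_hom)
  have "generate (G Mod H) {H #> a, H #> b} = carrier (G Mod H)"
    using q.generate_img[of "{a, b}"] assms by (simp add: carrier_FactGroup)
  moreover have "(H #> b) \<otimes>\<^bsub>G Mod H\<^esub> (H #> a) = (H #> a) \<otimes>\<^bsub>G Mod H\<^esub> (H #> b)"
    using coset_commute_iff assms by blast
  ultimately show "x \<otimes> y \<otimes> inv (y \<otimes> x) \<in> H" if "x \<in> carrier G" "y \<in> carrier G" for x y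
    using coset_commute_iff[OF that] that assms q.hom_closed
      q.H.commuting_generators[of "{H #> a, H #> b}" "H #> x" "H #> y"]
    by (auto simp del: mult_FactGroup)
qed

end

lemma (in group) ord_eqI:
  fixes d :: int
  assumes "x \<in> carrier G" "d \<ge> 0" "\<And>i::int. x [^] i = \<one> \<longleftrightarrow> d dvd i"
  shows "ord x = nat d"
proof -
  have "x [^] i = \<one> \<longleftrightarrow> nat d dvd i" for i :: nat
    using assms(3)[of "int i"] assms(2) int_dvd_int_iff[of "nat d" i] by (simp add: int_pow_int)
  then show ?thesis
    using ord_unique[OF assms(1)] by blast
qed

section \<open>The elements \<open>u\<close> and \<open>v\<close> and the derived subgroup\<close>

context G2_group
begin

lemma nf_mult_even:
  "even i \<Longrightarrow> even j \<Longrightarrow> even p \<Longrightarrow> even q \<Longrightarrow> nf i j \<otimes> nf p q = nf (i + p) (j + q)"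
  by (simp add: nf_mult twist_def)

lemma inv_nf_even: "even i \<Longrightarrow> even j \<Longrightarrow> inv (nf i j) = nf (- i) (- j)"
  by (rule inv_equality) (simp_all add: nf_mult_even)

text \<open>An abelian subgroup containing all squares; it records the parities of exponents in the
  argument against metacyclicity.\<close>

definition even_part :: "'a set" where
  "even_part = {nf p q |p q. even p \<and> even q}"

text \<open>Exponents are unique modulo \<open>4 * h\<close>, which is even, so their parities do
  not depend on the representation.\<close>

lemma nf_mem_even_part [simp]: "nf p q \<in> even_part \<longleftrightarrow> even p \<and> even q"
proof
  assume "nf p q \<in> even_part"
  then obtain p' q' where "even p'" "even q'" "nf p q = nf p' q'"
    by (auto simp: even_part_def)
  moreover from this have "4 * h dvd p - p'" "4 * h dvd q - q'"
    by (simp_all add: nf_eq_iff)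
  then have "2 dvd p - p'" "2 dvd q - q'"
    using dvd_trans[of 2 "4 * h"] by (metis dvd_triv_left mult.assoc mult_2 numeral_Bit0 distrib_right)+
  ultimately show "even p \<and> even q"
    by simp
qed (auto simp: even_part_def)

lemma subgroup_even_part: "subgroup even_part G"
proof (rule subgroupI)
  show "even_part \<noteq> {}"
    using nf_mem_even_part[of 0 0] by blast
qed (auto simp: even_part_def nf_mult_even inv_nf_even; metis even_minus even_add)+

lemma sq_mem_even_part: "x \<in> carrier G \<Longrightarrow> x [^] (2::int) \<in> even_part"
  by (auto simp: carrier_nf nf_sq)

definition u :: 'a where "u = a [^] (2::int) \<otimes> b [^] (- 2::int) \<otimes> z [^] k"
definition v :: 'a where "v = a [^] (4::int) \<otimes> z [^] l"

lemma u_nf: "u = nf (2 + 2 * h * k) (- 2 + 2 * h * k)"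
  using nf_z[of 2 "- 2" k] by (simp add: u_def nf_def)

lemma v_nf: "v = nf (4 + 2 * h * l) (2 * h * l)"
  using nf_z[of 4 0 l] by (simp add: v_def nf_def)

lemma u_closed [simp, intro]: "u \<in> carrier G" and v_closed [simp, intro]: "v \<in> carrier G"
  by (simp_all add: u_nf v_nf)

lemma u_pow: "u [^] (s::int) = nf ((2 + 2 * h * k) * s) ((- 2 + 2 * h * k) * s)"
  unfolding u_nf by (rule nf_int_pow_even) simp_all

lemma v_pow: "v [^] (t::int) = nf ((4 + 2 * h * l) * t) (2 * h * l * t)"
  unfolding v_nf by (rule nf_int_pow_even) simp_all

lemma u_pow_v_pow:
  "u [^] (s::int) \<otimes> v [^] (t::int) = nf ((2 + 2 * h * k) * s + (4 + 2 * h * l) * t) ((- 2 + 2 * h * k) * s + 2 * h * l * t)"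
  unfolding u_pow v_pow by (rule nf_mult_even) simp_all

text \<open>The difference of the two exponents of \<open>u^s\<close> is \<open>4 * s\<close>, free
  of \<open>k\<close>, and gives \<open>h dvd s\<close>. With \<open>s = h * r\<close> the first
  exponent is \<open>2 * h * r\<close> modulo \<open>4 * h\<close>, because \<open>k * h\<close> is
  even; this yields the remaining factor 2.\<close>

lemma u_pow_eq_one: "u [^] s = \<one> \<longleftrightarrow> 2 * h dvd s"
proof
  assume "u [^] s = \<one>"
  then have d: "4 * h dvd (2 + 2 * h * k) * s" "4 * h dvd (- 2 + 2 * h * k) * s"
    by (simp_all add: u_pow nf_eq_one_iff)
  have "(2 + 2 * h * k) * s - (- 2 + 2 * h * k) * s = 4 * s"
    by (simp add: algebra_simps)
  with dvd_diff[OF d] have "h dvd s"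
    by simp
  then obtain r where r: "s = h * r"
    by (elim dvdE)
  obtain c where c: "k * h = 2 * c"
    using even_kh by (elim evenE)
  have "(2 + 2 * h * k) * s = 2 * h * r + 2 * h * (k * h) * r"
    by (simp add: r algebra_simps)
  also have "\<dots> = 2 * h * r + 4 * h * (c * r)"
    unfolding c by simp
  finally have "4 * h dvd 2 * h * r + 4 * h * (c * r)"
    using d(1) by simp
  then have "4 * h dvd 2 * h * r"
    by (simp only: dvd_add_left_iff dvd_triv_left)
  then have "2 * h * 2 dvd 2 * h * r"
    by simp
  then have "2 dvd r"
    using h_pos by (simp only: dvd_mult_cancel_left) simp
  then show "2 * h dvd s"
    by (auto simp: r)
next
  assume "2 * h dvd s"
  then obtain r where "s = 2 * h * r"
    by (elim dvdE)
  then have "(2 + 2 * h * k) * s = 4 * h * (r + k * h * r)" "(- 2 + 2 * h * k) * s = 4 * h * (- r + k * h * r)"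
    by (simp_all add: algebra_simps)
  then show "u [^] s = \<one>"
    by (simp only: u_pow nf_eq_one_iff dvd_triv_left)
qed

text \<open>The difference of the two exponents of \<open>v^t\<close> is \<open>4 * t\<close>,
  whence \<open>h dvd t\<close>. This is also sufficient, since the contribution of \<open>z\<close>
  dies by evenness of \<open>l * h\<close>.\<close>

lemma v_pow_eq_one: "v [^] t = \<one> \<longleftrightarrow> h dvd t"
proof
  assume "v [^] t = \<one>"
  then have d: "4 * h dvd (4 + 2 * h * l) * t" "4 * h dvd 2 * h * l * t"
    by (simp_all add: v_pow nf_eq_one_iff)
  have "(4 + 2 * h * l) * t - 2 * h * l * t = 4 * t"
    by (simp add: algebra_simps)
  with dvd_diff[OF d] show "h dvd t"
    by simp
next
  assume "h dvd t"
  then obtain r where r: "t = h * r"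
    by (elim dvdE)
  obtain c where c: "l * h = 2 * c"
    using even_lh by (elim evenE)
  have "2 * h * l * t = 2 * h * (l * h) * r"
    by (simp add: r algebra_simps)
  also have "\<dots> = 4 * h * (c * r)"
    unfolding c by simp
  finally have e: "2 * h * l * t = 4 * h * (c * r)" .
  then have "(4 + 2 * h * l) * t = 4 * h * (r + c * r)"
    by (simp add: r algebra_simps)
  with e show "v [^] t = \<one>"
    by (simp only: v_pow nf_eq_one_iff dvd_triv_left)
qed

lemma ord_u: "ord u = nat (2 * h)" and ord_v: "ord v = nat h"
  using u_pow_eq_one v_pow_eq_one h_pos by (auto intro!: ord_eqI)

text \<open>Adding the congruences for the two exponents removes \<open>s\<close> up to a multiple
  of \<open>4 * h\<close> and leaves \<open>4 * h dvd 4 * t\<close>.\<close>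

lemma u_v_independent:
  assumes "u [^] (s::int) = v [^] (t::int)"
  shows "v [^] t = \<one>"
proof -
  have d: "4 * h dvd (2 + 2 * h * k) * s - (4 + 2 * h * l) * t" "4 * h dvd (- 2 + 2 * h * k) * s - 2 * h * l * t"
    using assms by (simp_all add: u_pow v_pow nf_eq_iff)
  have "(2 + 2 * h * k) * s - (4 + 2 * h * l) * t + ((- 2 + 2 * h * k) * s - 2 * h * l * t) =
      4 * h * (k * s - l * t) - 4 * t"
    by (simp add: algebra_simps)
  with dvd_add[OF d] have "4 * h dvd 4 * h * (k * s - l * t) - 4 * t"
    by simp
  then have "4 * h dvd 4 * t"
    by (metis dvd_diff_right_iff dvd_triv_left)
  then show ?thesis
    by (simp add: v_pow_eq_one)
qed

lemma generate_u: "generate G {u} = {u [^] s |s. s \<in> (UNIV :: int set)}"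
  and generate_v: "generate G {v} = {v [^] t |t. t \<in> (UNIV :: int set)}"
  by (simp_all add: generate_pow)

text \<open>Explicit form of the product of the subgroups generated by \<open>u\<close> and
  \<open>v\<close>: both elements have even exponents with sum divisible by 4, and
  \<open>generate_u_generate_v\<close> shows that there is no further constraint.\<close>

definition derived_nf :: "'a set" where
  "derived_nf = {nf p q |p q. even p \<and> even q \<and> 4 dvd p + q}"

lemma mem_derived_nfI: "even p \<Longrightarrow> even q \<Longrightarrow> 4 dvd p + q \<Longrightarrow> nf p q \<in> derived_nf"
  by (auto simp: derived_nf_def)

lemma generate_u_generate_v: "generate G {u} <#> generate G {v} = derived_nf"
proof (intro equalityI subsetI)
  fix x
  assume "x \<in> generate G {u} <#> generate G {v}"
  then obtain s t where "x = u [^] (s::int) \<otimes> v [^] (t::int)"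
    by (auto simp: set_mult_def generate_u generate_v)
  moreover have "u [^] s \<otimes> v [^] t \<in> derived_nf"
    unfolding u_pow_v_pow
  proof (rule mem_derived_nfI)
    have "(2 + 2 * h * k) * s + (4 + 2 * h * l) * t + ((- 2 + 2 * h * k) * s + 2 * h * l * t) =
        4 * (h * k * s + t + h * l * t)"
      by (simp add: algebra_simps)
    then show "4 dvd (2 + 2 * h * k) * s + (4 + 2 * h * l) * t + ((- 2 + 2 * h * k) * s + 2 * h * l * t)"
      by (metis dvd_triv_left)
  qed simp_all
  ultimately show "x \<in> derived_nf"
    by simp
next
  fix x
  assume "x \<in> derived_nf"
  then obtain p q where x: "x = nf p q" and pq: "even p" "even q" "4 dvd p + q"
    by (auto simp: derived_nf_def)
  obtain Q where Q: "q = 2 * Q"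
    using pq(2) by (elim evenE)
  obtain W where "p + q = 4 * W"
    using pq(3) by (elim dvdE)
  then have p: "p = 4 * W - 2 * Q"
    using Q by simp
  have "even ((k - l) * h)"
    using even_kh even_lh by (simp only: left_diff_distrib even_diff) simp
  then obtain g where g: "(k - l) * h = 2 * g"
    by (elim evenE)
  \<comment> \<open>Modulo \<open>4 * h\<close> the terms \<open>2 * h * k * s\<close> and \<open>2 * h * l * t\<close> only matter through the parity of
     \<open>k * s + l * t\<close>, which is that of \<open>c\<close>.\<close>
  define c where "c = - k * Q + l * W"
  define s where "s = - Q + h * c"
  define t where "t = W - h * c"
  \<comment> \<open>For k = l = 0 the solution is \<open>s = - Q\<close>, \<open>t = W\<close>. In
    general that choice overshoots both exponents by \<open>2 * h * c\<close>. Changing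
    \<open>s\<close> by \<open>h * c\<close> and \<open>t\<close> by \<open>- h * c\<close>
    compensates this in both, and the remainder is a multiple of \<open>4 * h\<close> because
    \<open>(k - l) * h\<close> is even.\<close>
  have "(2 + 2 * h * k) * s + (4 + 2 * h * l) * t - p = 2 * h * ((k - l) * h) * c"
    "(- 2 + 2 * h * k) * s + 2 * h * l * t - q = 2 * h * ((k - l) * h) * c"
    by (simp_all add: p Q s_def t_def c_def algebra_simps)
  moreover have "4 * h dvd 2 * h * ((k - l) * h) * c"
    unfolding g by simp
  ultimately have "x = u [^] s \<otimes> v [^] t"
    unfolding u_pow_v_pow x by (metis nf_eq_iff)
  then show "x \<in> generate G {u} <#> generate G {v}"
    unfolding set_mult_def generate_u generate_v by blast
qed

lemma subgroup_derived_nf: "subgroup derived_nf G"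
proof (rule subgroupI)
  show "derived_nf \<noteq> {}"
    using mem_derived_nfI[of 0 0] by auto
  show "inv x \<in> derived_nf" if "x \<in> derived_nf" for x
  proof -
    obtain p q where pq: "x = nf p q" "even p" "even q" "4 dvd p + q"
      using \<open>x \<in> derived_nf\<close> by (auto simp: derived_nf_def)
    then have "4 dvd - p + - q"
      by presburger
    then show ?thesis
      using pq inv_nf_even[of p q] mem_derived_nfI[of "- p" "- q"] by simp
  qed
  show "x \<otimes> y \<in> derived_nf" if xy: "x \<in> derived_nf" "y \<in> derived_nf" for x y
  proof -
    obtain p q where pq: "x = nf p q" "even p" "even q" "4 dvd p + q"
      using xy by (auto simp: derived_nf_def)
    obtain p' q' where pq': "y = nf p' q'" "even p'" "even q'" "4 dvd p' + q'"
      using xy by (auto simp: derived_nf_def)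
    have "4 dvd (p + p') + (q + q')"
      using pq pq' by presburger
    then show ?thesis
      using pq pq' nf_mult_even[of p q p' q'] mem_derived_nfI[of "p + p'" "q + q'"] by simp
  qed
qed (auto simp: derived_nf_def)

text \<open>Conjugation by an odd power of one generator inverts the part belonging to the other, up
  to a power of \<open>z\<close>. The exponent sum changes by \<open>2 * q\<close> or
  \<open>2 * p\<close> and a multiple of \<open>4 * h\<close>, all divisible by 4.\<close>

lemma derived_nf_normal: "derived_nf \<lhd> G"
proof (rule normal_if_generators[OF subgroup_derived_nf])
  fix s y
  assume s: "s \<in> {a, b}" and "y \<in> derived_nf"
  then obtain p q where y: "y = nf p q" and pq: "even p" "even q" "4 dvd p + q"
    by (auto simp: derived_nf_def)
  have a: "nf i 0 \<otimes> y \<otimes> nf (- i) 0 \<in> derived_nf" if "odd i" for i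
  proof -
    have eq: "nf i 0 \<otimes> y \<otimes> nf (- i) 0 = nf (p + 2 * h * twist (- i) q) (- q + 2 * h * twist (- i) q)"
      using that pq by (simp add: y nf_mult twist_def)
    show ?thesis
      unfolding eq
    proof (rule mem_derived_nfI)
      have "4 dvd (p + q) - 2 * q"
        using pq by presburger
      moreover have "(p + 2 * h * x) + (- q + 2 * h * x) = ((p + q) - 2 * q) + 4 * (h * x)" for x
        by simp
      ultimately show "4 dvd (p + 2 * h * twist (- i) q) + (- q + 2 * h * twist (- i) q)"
        by (metis dvd_add dvd_triv_left)
    qed (use pq in simp_all)
  qed
  have b: "nf 0 j \<otimes> y \<otimes> nf 0 (- j) \<in> derived_nf" if "odd j" for j
  proof -
    have eq: "nf 0 j \<otimes> y \<otimes> nf 0 (- j) = nf (- p + 2 * h * twist p j) (q + 2 * h * twist p j)"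
      using that pq by (simp add: y nf_mult twist_def)
    show ?thesis
      unfolding eq
    proof (rule mem_derived_nfI)
      have "4 dvd (p + q) - 2 * p"
        using pq by presburger
      moreover have "(- p + 2 * h * x) + (q + 2 * h * x) = ((p + q) - 2 * p) + 4 * (h * x)" for x
        by simp
      ultimately show "4 dvd (- p + 2 * h * twist p j) + (q + 2 * h * twist p j)"
        by (metis dvd_add dvd_triv_left)
    qed (use pq in simp_all)
  qed
  have "nf 1 0 = a" "nf (- 1) 0 = inv a" "nf 0 1 = b" "nf 0 (- 1) = inv b"
    by (simp_all add: nf_def int_pow_neg)
  then show "s \<otimes> y \<otimes> inv s \<in> derived_nf \<and> inv s \<otimes> y \<otimes> s \<in> derived_nf"
    using s a[of 1] a[of "- 1"] b[of 1] b[of "- 1"] by auto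
qed (auto simp: gen)

lemma b_a_u: "b \<otimes> a = a \<otimes> b \<otimes> u"
  using rel_ba by (simp add: u_def)

lemma u_mem: "u \<in> derived_nf" and v_mem: "v \<in> derived_nf"
proof -
  interpret U: subgroup "generate G {u}" G
    by (rule generate_is_subgroup) auto
  interpret V: subgroup "generate G {v}" G
    by (rule generate_is_subgroup) auto
  have "u \<in> generate G {u}" "v \<in> generate G {v}"
    by (auto intro: generate.incl)
  then have "u \<otimes> \<one> \<in> generate G {u} <#> generate G {v}" "\<one> \<otimes> v \<in> generate G {u} <#> generate G {v}"
    unfolding set_mult_def using U.one_closed V.one_closed by blast+
  then show "u \<in> derived_nf" "v \<in> derived_nf"
    by (simp_all add: generate_u_generate_v)
qed

text \<open>Modulo \<open>derived_nf\<close> the generators commute, because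
  \<open>b a = a b u\<close>. Conversely, \<open>u\<close> is the commutator of \<open>b\<close> and
  \<open>a\<close>, and \<open>v\<close> is the inverse of the commutator of \<open>a^2\<close> and
  \<open>b\<close>.\<close>

lemma derived_eq: "derived G (carrier G) = derived_nf"
proof
  interpret N: normal derived_nf G
    by (rule derived_nf_normal)
  have "b \<otimes> a \<otimes> inv (a \<otimes> b) = (a \<otimes> b) \<otimes> u \<otimes> inv (a \<otimes> b)"
    by (simp only: b_a_u)
  also have "\<dots> \<in> derived_nf"
    using u_mem by (intro N.inv_op_closed2) auto
  finally show "derived G (carrier G) \<subseteq> derived_nf"
    by (intro N.derived_subset_if_generators[OF gen]) auto
  have D: "subgroup (derived G (carrier G)) G"
    by (intro derived_is_subgroup) auto
  have comm: "x \<otimes> y \<otimes> inv x \<otimes> inv y \<in> derived G (carrier G)" if "x \<in> carrier G" "y \<in> carrier G" for x y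
    unfolding derived_def using that by (intro generate.incl) blast
  have "inv b \<otimes> inv a \<otimes> b \<otimes> a = u"
    by (simp add: m_assoc b_a_u)
  \<comment> \<open>\<open>derived\<close> is built from \<open>x y x^(-1) y^(-1)\<close>, so
    inverses are substituted to match the convention of the relations.\<close>
  then have "u \<in> derived G (carrier G)"
    using comm[of "inv b" "inv a"] by simp
  moreover have "v \<in> derived G (carrier G)"
  proof -
    have "inv (a [^] (2::int)) \<otimes> inv b \<otimes> a [^] (2::int) \<otimes> b = a [^] (- 2::int) \<otimes> (a [^] (- 2::int) \<otimes> z [^] l)"
      by (simp add: m_assoc rel_a2b int_pow_neg)
    also have "\<dots> = a [^] (- 4::int) \<otimes> z [^] l"
      by (simp add: collect)
    finally have eq: "inv (a [^] (2::int)) \<otimes> inv b \<otimes> a [^] (2::int) \<otimes> b = a [^] (- 4::int) \<otimes> z [^] l" .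
    have "z [^] (l + l) = \<one>"
      using z_cong[of "l + l" 0] by simp
    then have "v \<otimes> (a [^] (- 4::int) \<otimes> z [^] l) = \<one>"
      by (simp add: v_def collect)
    then have "inv (a [^] (- 4::int) \<otimes> z [^] l) = v"
      by (intro inv_equality) auto
    moreover have "inv (a [^] (2::int)) \<otimes> inv b \<otimes> a [^] (2::int) \<otimes> b \<in> derived G (carrier G)"
      using comm[of "inv (a [^] (2::int))" "inv b"] by simp
    ultimately show ?thesis
      unfolding eq using subgroup.m_inv_closed[OF D] by metis
  qed
  ultimately have "generate G {u} \<subseteq> derived G (carrier G)" "generate G {v} \<subseteq> derived G (carrier G)"
    using generate_subgroup_incl D by auto
  then have "generate G {u} <#> generate G {v} \<subseteq> derived G (carrier G)"
    unfolding set_mult_def using subgroup.m_closed[OF D] by blast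
  then show "derived_nf \<subseteq> derived G (carrier G)"
    by (simp add: generate_u_generate_v)
qed

lemma derived_direct_product:
  "internal_direct_product G (derived G (carrier G)) (generate G {u}) (generate G {v})"
  unfolding internal_direct_product_def
proof (intro conjI ballI)
  show "generate G {u} \<inter> generate G {v} = {\<one>}"
    using u_v_independent generate.one[of G "{u}"] generate.one[of G "{v}"]
    unfolding generate_u generate_v by auto
  show "x \<otimes> y = y \<otimes> x" if xy: "x \<in> generate G {u}" "y \<in> generate G {v}" for x y
  proof -
    obtain s t where "x = u [^] (s::int)" "y = v [^] (t::int)"
      using xy by (auto simp: generate_u generate_v)
    then show ?thesis
      by (simp add: u_pow v_pow nf_mult_even add.commute)
  qed
qed (auto simp: derived_eq generate_u_generate_v intro!: generate_is_subgroup)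

section \<open>The argument against metacyclicity\<close>

lemma z_nf: "z = nf (2 * h) (2 * h)"
  by (simp add: nf_def z_def)

lemma z_mem: "z \<in> derived_nf"
proof -
  have "4 dvd 2 * h + 2 * h"
    by simp
  then show ?thesis
    unfolding z_nf derived_nf_def by force
qed

text \<open>Even powers are powers of \<open>z^(twist i j)\<close>, while odd powers have odd
  exponents and so lie outside \<open>even_part\<close>.\<close>

lemma power_of_odd_nf:
  assumes "odd i" "odd j" and w: "w \<in> even_part" "w = nf i j [^] (r::int)"
  shows "\<exists>c. w = z [^] (twist i j * c)"
proof -
  have sq: "nf i j [^] (2 * c) = z [^] (twist i j * c)" for c :: int
  proof -
    have "nf i j [^] (2 * c) = (nf i j [^] (2::int)) [^] c"
      by (simp add: int_pow_pow)
    also have "nf i j [^] (2::int) = z [^] twist i j"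
      using assms by (simp add: nf_sq z_pow_nf)
    finally show ?thesis
      by (simp add: int_pow_pow)
  qed
  have "even r"
  proof (rule ccontr)
    assume "odd r"
    then obtain c where "r = 1 + 2 * c"
      by (metis oddE add.commute)
    then have "w = nf i j \<otimes> z [^] (twist i j * c)"
      by (simp only: w int_pow_mult nf_closed int_pow_1 sq)
    then show False
      using assms by (simp add: nf_z)
  qed
  then show ?thesis
    using sq w(2) by (auto elim!: evenE)
qed

text \<open>A cyclic normal subgroup with cyclic quotient contains the derived subgroup, hence
  \<open>z\<close> and \<open>v\<close>. The parities of its generator \<open>g = a^i b^j\<close>
  decide. If both exponents are even, a cyclic quotient cannot tell \<open>a\<close> from
  \<open>b\<close> modulo \<open>even_part\<close>. If exactly one is odd, the only involution among
  the powers of \<open>g\<close> is \<open>a^(2h)\<close> or \<open>b^(2h)\<close>, not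
  \<open>z\<close>. If both are odd, the powers of \<open>g\<close> are too few to contain both
  \<open>v\<close> and \<open>z\<close>.\<close>

lemma not_metacyclic: "\<not> metacyclic G"
proof
  assume "metacyclic G"
  then obtain N where N: "N \<lhd> G" and cyc: "cyclic_group (subgroup_generated G N)" "cyclic_group (G Mod N)"
    unfolding metacyclic_def by blast
  interpret N: normal N G
    by (rule N)
  interpret q: group_hom G "G Mod N" "\<lambda>x. N #> x"
    by (rule N.coset_group_hom)
  interpret K: subgroup even_part G
    by (rule subgroup_even_part)
  obtain g where "g \<in> N" and range: "N = range (\<lambda>r::int. g [^] r)"
    using cyc(1) group.cyclic_group[OF group_subgroup_generated[of N]]
    by (auto simp: int_pow_subgroup_generated)
  obtain i j where g: "g = nf i j"
    using \<open>g \<in> N\<close> N.mem_carrier carrier_nf by blast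
  interpret Q: comm_group "G Mod N"
    using q.H.cyclic_imp_abelian_group[OF cyc(2)] .
  have "derived G (carrier G) \<subseteq> N"
    using N.coset_commute_iff Q.m_comm q.hom_closed N.derived_subset_iff by blast
  then have "z \<in> N" "v \<in> N"
    using z_mem v_mem derived_eq by auto
  then obtain r r' where r: "z = g [^] (r::int)" and r': "v = g [^] (r'::int)"
    using range by blast
  have z_v_even: "z \<in> even_part" "v \<in> even_part"
    unfolding v_nf by (simp_all add: z_nf)
  \<comment> \<open>In a cyclic group of order \<open>4 * h\<close> an element with trivial square
    is a power of the \<open>2 * h\<close>-th power of the generator.\<close>
  have half: "\<exists>c. z = (g [^] (2 * h)) [^] (c::int)" if "ord g = nat (4 * h)"
  proof -
    have "g [^] (2 * r) = \<one>"
      using z_sq unfolding r by (simp add: g int_pow_pow mult.commute)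
    then have "4 * h dvd 2 * r"
      using that h_pos int_pow_eq_id[of g "2 * r"] by (simp add: g)
    then have "2 * h dvd r"
      by (metis dvd_times_left_cancel_iff mult.assoc mult_2 numeral_Bit0 zero_neq_numeral)
    then obtain c where "r = 2 * h * c"
      by (elim dvdE)
    then show ?thesis
      using r by (auto simp: g int_pow_pow)
  qed
  consider "even i" "even j" | "odd i" "even j" | "even i" "odd j" | "odd i" "odd j"
    by blast
  then show False
  proof cases
    case 1
    then have sub: "N \<subseteq> even_part"
      using subgroup_int_pow_closed[OF subgroup_even_part] g by (auto simp: range)
    obtain C where C: "C \<in> carrier (G Mod N)" "carrier (G Mod N) = range (\<lambda>r::int. C [^]\<^bsub>G Mod N\<^esub> r)"
      using cyc(2) q.H.cyclic_group by blast
    obtain x where x: "x \<in> carrier G" "C = N #> x"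
      using C(1) by (auto simp: carrier_FactGroup)
    \<comment> \<open>Modulo \<open>N\<close>, and hence modulo \<open>even_part\<close>,
      \<open>y\<close> is a power of \<open>x\<close>. The exponent is odd because even powers of
      \<open>x\<close> lie in \<open>even_part\<close>, so \<open>y\<close> and \<open>x\<close>
      agree modulo \<open>even_part\<close>. Applied to \<open>a\<close> and \<open>b\<close>, this
      puts \<open>a b^(-1)\<close> into \<open>even_part\<close>.\<close>
    have step: "y \<otimes> inv x \<in> even_part" if y: "y \<in> carrier G" "y \<notin> even_part" for y
    proof -
      obtain s :: int where "N #> y = C [^]\<^bsub>G Mod N\<^esub> s"
        using q.hom_closed[OF y(1)] C(2) by blast
      then have "N #> y = N #> (x [^] s)"
        using x by (simp add: N.FactGroup_int_pow)
      then have *: "y \<otimes> inv (x [^] s) \<in> even_part"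
        using sub r_coset_eq_iff[OF N.subgroup_axioms y(1), of "x [^] s"] x by auto
      have ev: "x [^] (2 * c) \<in> even_part" for c :: int
        using subgroup_int_pow_closed[OF subgroup_even_part sq_mem_even_part[OF x(1)], of c] x(1)
        by (simp add: int_pow_pow)
      have "odd s"
      proof
        assume "even s"
        then have "y \<otimes> inv (x [^] s) \<otimes> x [^] s \<in> even_part"
          using * ev by (auto elim!: evenE)
        then show False
          using y x by (simp add: m_assoc)
      qed
      then obtain c where s: "s = 1 + 2 * c"
        by (metis oddE add.commute)
      have "y \<otimes> inv x = y \<otimes> inv (x [^] s) \<otimes> x [^] (2 * c)"
        using y x by (simp add: s m_assoc int_pow_mult[symmetric] int_pow_neg[symmetric] inv_mult_group)
          (simp add: int_pow_neg)
      then show ?thesis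
        using * ev by simp
    qed
    have nf_ab: "nf 1 0 = a" "nf 0 1 = b" "nf 1 (- 1) = a \<otimes> inv b"
      by (simp_all add: nf_def int_pow_neg)
    have "a \<notin> even_part" "b \<notin> even_part"
      using nf_mem_even_part[of 1 0] nf_mem_even_part[of 0 1] by (simp_all add: nf_ab)
    then have "(a \<otimes> inv x) \<otimes> inv (b \<otimes> inv x) \<in> even_part"
      using step by simp
    then have "a \<otimes> inv b \<in> even_part"
      using x by (simp add: m_assoc inv_mult_group)
    then show False
      using nf_mem_even_part[of 1 "- 1"] by (simp add: nf_ab)
  next
    case 2
    then obtain c where "z = (a [^] (2 * h)) [^] (c::int)"
      using half ord_nf[of i j] nf_pow_half[of i j] by (auto simp: g)
    then have "nf (2 * h) (2 * h) = nf (2 * h * c) 0"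
      using a_pow_nf[of "2 * h * c"] by (simp add: z_nf int_pow_pow)
    then show False
      using dvd_2h by (simp add: nf_eq_iff)
  next
    case 3
    then obtain c where "z = (b [^] (2 * h)) [^] (c::int)"
      using half ord_nf[of i j] nf_pow_half[of i j] by (auto simp: g)
    then have "nf (2 * h) (2 * h) = nf 0 (2 * h * c)"
      using b_pow_nf[of "2 * h * c"] by (simp add: z_nf int_pow_pow)
    then show False
      using dvd_2h by (simp add: nf_eq_iff)
  next
    case 4
    obtain c where c: "v = z [^] (twist i j * c)"
      using power_of_odd_nf[OF 4 z_v_even(2)] r' g by blast
    define x where "x = 2 * h * (twist i j * c)"
    have "4 * h dvd (4 + 2 * h * l) - x" "4 * h dvd 2 * h * l - x"
      using c by (simp_all add: v_nf z_pow_nf nf_eq_iff x_def)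
    \<comment> \<open>A power of \<open>z\<close> has equal exponents, so the difference of the two
      conditions is \<open>4 * h dvd 4\<close>. In the resulting case n = 4 both \<open>k\<close>
      and \<open>l\<close> vanish, and with them \<open>twist\<close>, which forces \<open>z\<close>
      to be trivial.\<close>
    from dvd_diff[OF this] have "h = 1"
      using h_pos zdvd_imp_le[of "4 * h" 4] by simp
    then have "twist i j = 0"
      using odd_h 4 unfolding twist_def by simp
    moreover obtain c where "z = z [^] (twist i j * c)"
      using power_of_odd_nf[OF 4 z_v_even(1)] r g by blast
    ultimately have "z = \<one>"
      by simp
    then show False
      using central_involutions(2)[of z] by simp
  qed
qed

end

section \<open>The upper central series\<close>

lemma (in group) subgroup_group_center: "subgroup (group_center G) G"
proof (rule subgroupI)
  show "group_center G \<subseteq> carrier G"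
    unfolding group_center_def by blast
  have "\<one> \<in> group_center G"
    by (simp add: group_center_def)
  then show "group_center G \<noteq> {}"
    by blast
  show "inv x \<in> group_center G" if "x \<in> group_center G" for x
  proof -
    have x: "x \<in> carrier G"
      using that by (simp add: group_center_def)
    have "inv x \<otimes> y = y \<otimes> inv x" if y: "y \<in> carrier G" for y
    proof -
      have "y \<otimes> x = x \<otimes> y"
        using \<open>x \<in> group_center G\<close> y by (simp add: group_center_def)
      then show ?thesis
        using x y int_pow_commute_left[of x y "- 1"] by (simp add: int_pow_neg)
    qed
    then show ?thesis
      using x by (simp add: group_center_def)
  qed
  show "x \<otimes> y \<in> group_center G" if "x \<in> group_center G" "y \<in> group_center G" for x y
  proof -
    have x: "x \<in> carrier G" "\<And>w. w \<in> carrier G \<Longrightarrow> x \<otimes> w = w \<otimes> x"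
      and y: "y \<in> carrier G" "\<And>w. w \<in> carrier G \<Longrightarrow> y \<otimes> w = w \<otimes> y"
      using that by (simp_all add: group_center_def)
    have "x \<otimes> y \<otimes> w = w \<otimes> (x \<otimes> y)" if w: "w \<in> carrier G" for w
    proof -
      have "x \<otimes> y \<otimes> w = x \<otimes> (w \<otimes> y)"
        using x(1) y w by (simp add: m_assoc)
      also have "\<dots> = w \<otimes> x \<otimes> y"
        using x y(1) w by (simp flip: m_assoc)
      finally show ?thesis
        using x(1) y(1) w by (simp add: m_assoc)
    qed
    then show ?thesis
      using x(1) y(1) by (simp add: group_center_def)
  qed
qed

lemma (in normal) preimage_center_normal:
  "{x \<in> carrier G. H #> x \<in> group_center (G Mod H)} \<lhd> G" (is "?Z \<lhd> G")
proof -
  interpret q: group_hom G "G Mod H" "\<lambda>x. H #> x"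
    by (rule coset_group_hom)
  interpret C: subgroup "group_center (G Mod H)" "G Mod H"
    by (rule q.H.subgroup_group_center)
  show ?thesis
  proof (rule normal_invI)
    show "subgroup ?Z G"
    proof (rule subgroupI)
      have "\<one> \<in> ?Z"
        using q.hom_one C.one_closed by simp
      then show "?Z \<noteq> {}"
        by blast
      show "inv x \<in> ?Z" if "x \<in> ?Z" for x
        using that q.hom_inv[of x] C.m_inv_closed[of "H #> x"] by auto
      show "x \<otimes> y \<in> ?Z" if "x \<in> ?Z" "y \<in> ?Z" for x y
        using that q.hom_mult[of x y] C.m_closed[of "H #> x" "H #> y"] by auto
    qed auto
    fix g x
    assume g: "g \<in> carrier G" and x: "x \<in> ?Z"
    then have x: "x \<in> carrier G" "H #> x \<in> group_center (G Mod H)"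
      by simp_all
    then have comm: "(H #> g) \<otimes>\<^bsub>G Mod H\<^esub> (H #> x) = (H #> x) \<otimes>\<^bsub>G Mod H\<^esub> (H #> g)"
      using q.hom_closed[OF g] unfolding group_center_def by auto
    have "H #> (g \<otimes> x \<otimes> inv g) =
        (H #> g) \<otimes>\<^bsub>G Mod H\<^esub> (H #> x) \<otimes>\<^bsub>G Mod H\<^esub> (H #> inv g)"
      using g x(1) by (simp only: q.hom_mult m_closed inv_closed)
    also have "\<dots> = H #> (x \<otimes> g \<otimes> inv g)"
      unfolding comm using g x(1) by (simp only: q.hom_mult m_closed inv_closed)
    also have "x \<otimes> g \<otimes> inv g = x"
      using g x(1) by (simp add: m_assoc)
    finally have "H #> (g \<otimes> x \<otimes> inv g) = H #> x" .
    then show "g \<otimes> x \<otimes> inv g \<in> ?Z"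
      using g x by simp
  qed
qed

lemma (in group) upper_central_normal: "upper_central G i \<lhd> G"
proof (induction i)
  case 0
  then show ?case
    by (simp add: one_is_normal)
next
  case (Suc i)
  then show ?case
    using normal.preimage_center_normal by simp
qed

context G2_group
begin

text \<open>Centrality in the quotient need only be tested on the images of the generators. The two
  quotients are ordered so that for a normal form \<open>x\<close> a power of \<open>b\<close>
  stands before a power of \<open>a\<close>, ready for collection.\<close>

lemma mod_center_iff:
  assumes "N \<lhd> G" "x \<in> carrier G"
  shows "N #> x \<in> group_center (G Mod N) \<longleftrightarrow>
    x \<otimes> a \<otimes> inv (a \<otimes> x) \<in> N \<and> b \<otimes> x \<otimes> inv (x \<otimes> b) \<in> N"
proof -
  interpret N: normal N G
    by fact
  interpret q: group_hom G "G Mod N" "\<lambda>x. N #> x"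
    by (rule N.coset_group_hom)
  have gen_q: "generate (G Mod N) {N #> a, N #> b} = carrier (G Mod N)"
    using q.generate_img[of "{a, b}"] by (simp add: carrier_FactGroup gen)
  have "N #> x \<in> group_center (G Mod N) \<longleftrightarrow>
    (\<forall>y \<in> {N #> a, N #> b}. (N #> x) \<otimes>\<^bsub>G Mod N\<^esub> y = y \<otimes>\<^bsub>G Mod N\<^esub> (N #> x))" (is "?l \<longleftrightarrow> ?r")
  proof
    assume ?l
    then show ?r
      using q.hom_closed unfolding group_center_def by blast
  next
    assume ?r
    then have "(N #> x) \<otimes>\<^bsub>G Mod N\<^esub> y = y \<otimes>\<^bsub>G Mod N\<^esub> (N #> x)" if "y \<in> carrier (G Mod N)" for y
      using that q.H.commute_generate[of "N #> x" "{N #> a, N #> b}" y] q.hom_closed assms(2) gen_q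
      by (auto simp del: mult_FactGroup)
    then show ?l
      using q.hom_closed[OF assms(2)] by (simp add: group_center_def)
  qed
  also have "\<dots> \<longleftrightarrow> x \<otimes> a \<otimes> inv (a \<otimes> x) \<in> N \<and> b \<otimes> x \<otimes> inv (x \<otimes> b) \<in> N"
    using N.coset_commute_iff[OF assms(2) a_closed] N.coset_commute_iff[OF b_closed assms(2)]
    by (simp del: mult_FactGroup) metis
  finally show ?thesis .
qed

text \<open>With \<open>D = 2 ^ (e - i)\<close> this is the candidate for term \<open>i\<close> of
  the upper central series, ranging from the trivial group at \<open>D = 4 * h\<close> to the whole
  group at \<open>D = 1\<close>.\<close>

definition nf_multiples :: "int \<Rightarrow> 'a set" where
  "nf_multiples D = {nf p q |p q. D dvd p \<and> D dvd q}"

lemma nf_mem_multiples: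
  assumes "D dvd 4 * h"
  shows "nf p q \<in> nf_multiples D \<longleftrightarrow> D dvd p \<and> D dvd q"
proof
  assume "nf p q \<in> nf_multiples D"
  then obtain p' q' where *: "D dvd p'" "D dvd q'" "nf p q = nf p' q'"
    by (auto simp: nf_multiples_def)
  then have "D dvd p - p'" "D dvd q - q'"
    using dvd_trans[OF assms] by (auto simp: nf_eq_iff)
  then have "D dvd (p - p') + p'" "D dvd (q - q') + q'"
    using * dvd_add by blast+
  then show "D dvd p \<and> D dvd q"
    by simp
qed (auto simp: nf_multiples_def)

lemma conj_quotient:
  assumes "x \<in> carrier G" "y \<in> carrier G" "w \<in> carrier G" "g \<in> carrier G"
    and "x = g \<otimes> y \<otimes> inv g \<otimes> w" "N \<lhd> G"
  shows "x \<otimes> inv w \<in> N \<longleftrightarrow> y \<in> N"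
proof -
  have "x \<otimes> inv w = g \<otimes> y \<otimes> inv g"
    unfolding assms(5) using assms(2-4) by (simp add: m_assoc)
  then show ?thesis
    using normal.conj_mem_iff[OF assms(6)] assms by simp
qed

text \<open>Conjugating away a power of \<open>a\<close> leaves an element independent of
  \<open>p\<close>. Since \<open>nf_b_commutator\<close> is likewise independent of
  \<open>q\<close>, the test for centrality separates into one condition on each exponent.\<close>

lemma nf_a_commutator:
  assumes "N \<lhd> G"
  shows "nf p q \<otimes> a \<otimes> inv (a \<otimes> nf p q) \<in> N \<longleftrightarrow>
    nf ((if even q then 0 else - 2) + 2 * h * twist 1 q) (- 2 * q + 2 * h * twist 1 q) \<in> N"
proof -
  define t where "t = twist 1 q"
  \<comment> \<open>\<open>1 + c\<close> is the exponent with which \<open>a\<close> emerges from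
    collection: 1 for even \<open>q\<close> and -1 for odd \<open>q\<close>.\<close>
  define c :: int where "c = (if even q then 0 else - 2)"
  have "b [^] q \<otimes> a = a [^] (1 + c) \<otimes> b [^] (- q) \<otimes> z [^] t"
    using b_pow_a_pow[of q 1] by (simp add: t_def c_def split: if_splits)
  then have "nf p q \<otimes> a = a [^] p \<otimes> (a [^] (1 + c) \<otimes> b [^] (- q) \<otimes> z [^] t)"
    by (simp add: nf_def m_assoc)
  also have "\<dots> = a [^] (p + 1) \<otimes> (nf c (- 2 * q) \<otimes> z [^] t) \<otimes> inv (a [^] (p + 1)) \<otimes> (a \<otimes> nf p q)"
  proof -
    have "inv (a [^] (p + 1)) \<otimes> (a \<otimes> nf p q) = b [^] q"
      using a_pow_a_pow_assoc[of "b [^] q" 1 p] by (simp add: nf_def add.commute)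
    then show ?thesis
      by (simp add: nf_def collect add.assoc)
  qed
  finally have "nf p q \<otimes> a = a [^] (p + 1) \<otimes> (nf c (- 2 * q) \<otimes> z [^] t) \<otimes> inv (a [^] (p + 1)) \<otimes> (a \<otimes> nf p q)" .
  then have "nf p q \<otimes> a \<otimes> inv (a \<otimes> nf p q) \<in> N \<longleftrightarrow> nf c (- 2 * q) \<otimes> z [^] t \<in> N"
    by (intro conj_quotient[OF _ _ _ _ _ assms]) auto
  then show ?thesis
    by (simp only: nf_z t_def c_def)
qed

lemma nf_b_commutator:
  assumes "N \<lhd> G"
  shows "b \<otimes> nf p q \<otimes> inv (nf p q \<otimes> b) \<in> N \<longleftrightarrow>
    nf (- 2 * p + 2 * h * twist p 1) ((if even p then 0 else - 2) + 2 * h * twist p 1) \<in> N"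
proof -
  define t where "t = twist p 1"
  define c :: int where "c = (if even p then 0 else - 2)"
  have "b \<otimes> a [^] p = a [^] (- p) \<otimes> b [^] (1 + c) \<otimes> z [^] t"
    using b_pow_a_pow[of 1 p] by (simp add: t_def c_def split: if_splits)
  then have "b \<otimes> nf p q = a [^] (- p) \<otimes> b [^] (1 + c) \<otimes> z [^] t \<otimes> b [^] q"
    by (simp add: nf_def m_assoc[symmetric])
  also have "\<dots> = a [^] p \<otimes> (nf (- 2 * p) c \<otimes> z [^] t) \<otimes> inv (a [^] p) \<otimes> (nf p q \<otimes> b)"
  proof -
    have "inv (a [^] p) \<otimes> (nf p q \<otimes> b) = b [^] (q + 1)"
      by (simp add: nf_def m_assoc int_pow_mult)
    then show ?thesis
      by (simp add: nf_def collect ac_simps)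
  qed
  finally have "b \<otimes> nf p q = a [^] p \<otimes> (nf (- 2 * p) c \<otimes> z [^] t) \<otimes> inv (a [^] p) \<otimes> (nf p q \<otimes> b)" .
  then have "b \<otimes> nf p q \<otimes> inv (nf p q \<otimes> b) \<in> N \<longleftrightarrow> nf (- 2 * p) c \<otimes> z [^] t \<in> N"
    by (intro conj_quotient[OF _ _ _ _ _ assms]) auto
  then show ?thesis
    by (simp only: nf_z t_def c_def)
qed

text \<open>\<open>2 * D\<close> belongs to the current term of the series and \<open>D\<close> to
  the next. For even \<open>D\<close> and odd \<open>q\<close> the first expression, halved, is odd.
  If \<open>q\<close> is even and \<open>D dvd q\<close>, then \<open>h * t\<close> must vanish
  modulo \<open>D\<close>: this is clear for \<open>D dvd h\<close>, and for
  \<open>D = 2 * h\<close> the number \<open>t\<close> contains the even factor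
  \<open>l * h\<close>.\<close>

lemma commutator_arith:
  fixes D q t :: int
  assumes D: "D = 1 \<or> even D" "D dvd h \<or> D = 2 * h"
    and t: "even q \<Longrightarrow> t = l * (q div 2)" "t = 0 \<or> even h"
  shows "2 * D dvd (if even q then 0 else - 2) + 2 * h * t \<and> 2 * D dvd - 2 * q + 2 * h * t \<longleftrightarrow> D dvd q"
proof -
  have "2 * D dvd (if even q then 0 else - 2) + 2 * h * t \<longleftrightarrow> D dvd (if even q then 0 else - 1) + h * t"
    using dvd_times_left_cancel_iff[of 2 D "h * t"] dvd_times_left_cancel_iff[of 2 D "h * t - 1"]
    by (simp add: right_diff_distrib mult.assoc)
  moreover have "2 * D dvd - 2 * q + 2 * h * t \<longleftrightarrow> D dvd - q + h * t"
    using dvd_times_left_cancel_iff[of 2 D "- q + h * t"]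
    by (simp add: distrib_left mult.assoc)
  moreover have "D dvd (if even q then 0 else - 1) + h * t \<and> D dvd - q + h * t \<longleftrightarrow> D dvd q"
  proof (cases "D = 1")
    case False
    then have "even D"
      using D by blast
    show ?thesis
    proof (cases "even q")
      case True
      show ?thesis
      proof
        assume "D dvd (if even q then 0 else - 1) + h * t \<and> D dvd - q + h * t"
        then have "D dvd h * t - (- q + h * t)"
          by (simp only: True if_True add_0_left dvd_diff)
        then show "D dvd q"
          by simp
      next
        assume q: "D dvd q"
        have "D dvd h * t"
          using D(2)
        proof
          assume D2: "D = 2 * h"
          obtain r where "q = 2 * h * r"
            using q unfolding D2 by (elim dvdE)
          then have "t = l * h * r"
            using t(1) True by simp
          then have "even t"
            using even_lh by simp
          then show ?thesis
            unfolding D2 by (auto elim!: evenE)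
        qed auto
        then show "D dvd (if even q then 0 else - 1) + h * t \<and> D dvd - q + h * t"
          using q True by (simp add: dvd_add)
      qed
    next
      case False
      have "even (h * t)"
        using t(2) by auto
      then have "odd (- 1 + h * t)"
        by simp
      then have "\<not> D dvd - 1 + h * t" "\<not> D dvd q"
        using False dvd_trans[OF \<open>even D\<close>] by blast+
      then show ?thesis
        by (simp only: False if_False simp_thms)
    qed
  qed simp
  ultimately show ?thesis
    by simp
qed

lemma upper_central_step:
  assumes normal: "nf_multiples (2 * D) \<lhd> G" and D: "D = 1 \<or> even D" "D dvd h \<or> D = 2 * h"
  shows "{x \<in> carrier G. nf_multiples (2 * D) #> x \<in> group_center (G Mod nf_multiples (2 * D))} = nf_multiples D"
proof -
  have dvd: "D dvd 4 * h" "2 * D dvd 4 * h"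
    using D(2) by (auto elim!: dvdE)
  have "nf_multiples (2 * D) #> nf p q \<in> group_center (G Mod nf_multiples (2 * D)) \<longleftrightarrow> D dvd p \<and> D dvd q" for p q
  proof -
    have "2 * D dvd (if even q then 0 else - 2) + 2 * h * twist 1 q \<and> 2 * D dvd - 2 * q + 2 * h * twist 1 q \<longleftrightarrow> D dvd q"
      using odd_h by (intro commutator_arith[OF D]) (auto simp: twist_def)
    moreover have "2 * D dvd (if even p then 0 else - 2) + 2 * h * twist p 1 \<and> 2 * D dvd - 2 * p + 2 * h * twist p 1 \<longleftrightarrow> D dvd p"
      using odd_h by (intro commutator_arith[OF D]) (auto simp: twist_def)
    ultimately show ?thesis
      unfolding mod_center_iff[OF normal nf_closed] nf_a_commutator[OF normal] nf_b_commutator[OF normal]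
        nf_mem_multiples[OF dvd(2)] by blast
  qed
  then show ?thesis
    by (auto simp: carrier_nf nf_multiples_def)
qed

lemma upper_central_eq:
  assumes "4 * h = 2 ^ e" "i \<le> e"
  shows "upper_central G i = nf_multiples (2 ^ (e - i))"
  using assms(2)
proof (induction i)
  case 0
  have "nf_multiples (4 * h) = {\<one>}"
    using nf_eq_one_iff nf_0[symmetric] unfolding nf_multiples_def by blast
  then show ?case
    using assms(1) by simp
next
  case (Suc i)
  define D :: int where "D = 2 ^ (e - Suc i)"
  have "e - i = Suc (e - Suc i)"
    using Suc.prems by simp
  then have i: "upper_central G i = nf_multiples (2 * D)"
    using Suc by (simp add: D_def)
  have e: "e \<ge> 2" "h = 2 ^ (e - 2)"
  proof -
    show "e \<ge> 2"
    proof (rule ccontr)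
      assume "\<not> e \<ge> 2"
      then have "e = 0 \<or> e = 1"
        by auto
      then show False
        using assms(1) h_pos by auto
    qed
    then obtain d where "e = d + 2"
      by (metis le_add_diff_inverse2)
    then show "h = 2 ^ (e - 2)"
      using assms(1) by simp
  qed
  have "D = 1 \<or> even D"
    by (cases "e - Suc i") (simp_all add: D_def)
  \<comment> \<open>The exceptional value \<open>D = 2 * h\<close> belongs to \<open>i = 0\<close>,
    the step from the trivial group to the centre.\<close>
  moreover have "D dvd h \<or> D = 2 * h"
  proof (cases i)
    case 0
    then have "e - Suc i = Suc (e - 2)"
      using e by simp
    then show ?thesis
      using e by (simp add: D_def)
  next
    case (Suc j)
    then show ?thesis
      using e by (auto simp: D_def intro: le_imp_power_dvd)
  qed
  ultimately show ?case
    using upper_central_step[of D] upper_central_normal[of i] by (simp add: i D_def)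
qed

lemma generate_a_generate_b_powers:
  fixes D :: nat
  shows "generate G {a [^] D} <#> generate G {b [^] D} = nf_multiples (int D)"
proof -
  have gens: "generate G {a [^] D} = {a [^] (int D * i) |i. True}" "generate G {b [^] D} = {b [^] (int D * i) |i. True}"
    by (simp_all add: generate_pow int_pow_pow flip: int_pow_int)
  show ?thesis
  proof (intro equalityI subsetI)
    fix x
    assume "x \<in> generate G {a [^] D} <#> generate G {b [^] D}"
    then show "x \<in> nf_multiples (int D)"
      unfolding gens set_mult_def nf_multiples_def nf_def by fastforce
  next
    fix x
    assume "x \<in> nf_multiples (int D)"
    then show "x \<in> generate G {a [^] D} <#> generate G {b [^] D}"
      unfolding gens set_mult_def nf_multiples_def nf_def by (auto elim!: dvdE)
  qed
qed

lemma upper_central_strict: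
  assumes "4 * h = 2 ^ e" "i < e"
  shows "upper_central G i \<subset> upper_central G (Suc i)"
proof -
  have *: "e - i = Suc (e - Suc i)"
    using assms(2) by simp
  have dvd: "(2::int) ^ (e - i) dvd 4 * h" "(2::int) ^ (e - Suc i) dvd 4 * h"
    unfolding assms(1) by (simp_all add: le_imp_power_dvd)
  have "nf (2 ^ (e - Suc i)) 0 \<in> nf_multiples (2 ^ (e - Suc i))"
    by (simp add: nf_mem_multiples[OF dvd(2)])
  moreover have "\<not> (2::int) ^ (e - i) dvd 2 ^ (e - Suc i)"
    unfolding * by (simp add: power_dvd_imp_le)
  then have "nf (2 ^ (e - Suc i)) 0 \<notin> nf_multiples (2 ^ (e - i))"
    by (simp add: nf_mem_multiples[OF dvd(1)])
  moreover have "nf_multiples (2 ^ (e - i)) \<subseteq> nf_multiples (2 ^ (e - Suc i))"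
    unfolding nf_multiples_def * by (auto intro: dvd_mult_right)
  ultimately show ?thesis
    using assms upper_central_eq[of e i] upper_central_eq[of e "Suc i"] by auto
qed

lemma upper_central_top:
  assumes "4 * h = 2 ^ e"
  shows "upper_central G e = carrier G"
proof -
  have "nf_multiples 1 = carrier G"
    by (rule Set.set_eqI) (simp add: nf_multiples_def carrier_nf)
  then show ?thesis
    using upper_central_eq[OF assms, of e] by simp
qed

lemma nilpotence_class:
  assumes "4 * h = 2 ^ e"
  shows "has_nilpotence_class G e"
  unfolding has_nilpotence_class_def
proof (intro conjI allI impI)
  show "upper_central G e = carrier G"
    using assms by (rule upper_central_top)
  show "upper_central G d \<noteq> carrier G" if "d < e" for d
    using upper_central_strict[OF assms that]
      subgroup.subset[OF normal_imp_subgroup[OF upper_central_normal[of "Suc d"]]] by blast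
qed

end

section \<open>Transfer to the presented group\<close>

text \<open>By the universal property \<open>G2\<close> maps to the model. A relation
  \<open>a^i b^j = 1\<close> is carried to the corresponding relation there, which forces both
  exponents to be divisible by n.\<close>

lemma G2_group_G2:
  assumes e: "e \<ge> 2" and kl: "k \<in> {0, 1}" "l \<in> {0, 1}" "e = 2 \<Longrightarrow> k = 0 \<and> l = 0"
  shows "G2_group (G2 e k l) (2 ^ (e - 2)) (int k) (int l) (G2_a e k l) (G2_b e k l)
    (G2_a e k l [^]\<^bsub>G2 e k l\<^esub> (2 * 2 ^ (e - 2) :: int) \<otimes>\<^bsub>G2 e k l\<^esub>
     G2_b e k l [^]\<^bsub>G2 e k l\<^esub> (2 * 2 ^ (e - 2) :: int))"
proof -
  define G where "G = G2 e k l"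
  define a where "a = G2_a e k l"
  define b where "b = G2_b e k l"
  have group: "group G" and c: "a \<in> carrier G" "b \<in> carrier G"
    by (simp_all add: G_def a_def b_def group_G2 G2_gens_closed)
  interpret rel: G2_relations G "2 ^ (e - 2)" "int k" "int l" a b
    "a [^]\<^bsub>G\<^esub> (2 * 2 ^ (e - 2) :: int) \<otimes>\<^bsub>G\<^esub> b [^]\<^bsub>G\<^esub> (2 * 2 ^ (e - 2) :: int)"
    using satisfies_G2_rels_iff[OF group e kl c] G2_satisfies_rels[of e k l]
    by (simp only: G_def a_def b_def)
  interpret model: G2_model "2 ^ (e - 2)" "int k" "int l"
    by unfold_locales (use rel.h_pos rel.k rel.l rel.odd_h in auto)
  have "satisfies_G2_rels model.M e k l model.A model.B"
    using satisfies_G2_rels_iff[OF model.M.is_group e kl model.A_closed model.B_closed]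
      model.satisfies_relations model.Z_eq by simp
  then obtain \<phi> where "\<phi> \<in> hom G model.M" and \<phi>: "\<phi> a = model.A" "\<phi> b = model.B"
    using G2_universal[OF model.M.is_group model.A_closed model.B_closed] by (metis G_def a_def b_def)
  then interpret \<phi>: group_hom G model.M \<phi>
    using group model.M.is_group by (simp add: group_hom_def group_hom_axioms_def)
  have "G2_group G (2 ^ (e - 2)) (int k) (int l) a b
    (a [^]\<^bsub>G\<^esub> (2 * 2 ^ (e - 2) :: int) \<otimes>\<^bsub>G\<^esub> b [^]\<^bsub>G\<^esub> (2 * 2 ^ (e - 2) :: int))"
  proof
    show "generate G {a, b} = carrier G"
      by (simp add: G_def a_def b_def G2_generated)
    show "4 * 2 ^ (e - 2) dvd i \<and> 4 * 2 ^ (e - 2) dvd j"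
      if "a [^]\<^bsub>G\<^esub> i \<otimes>\<^bsub>G\<^esub> b [^]\<^bsub>G\<^esub> j = \<one>\<^bsub>G\<^esub>" for i j :: int
    proof (rule model.independent)
      have "\<phi> (a [^]\<^bsub>G\<^esub> i \<otimes>\<^bsub>G\<^esub> b [^]\<^bsub>G\<^esub> j) = \<one>\<^bsub>model.M\<^esub>"
        unfolding that by (rule \<phi>.hom_one)
      then show "model.A [^]\<^bsub>model.M\<^esub> i \<otimes>\<^bsub>model.M\<^esub> model.B [^]\<^bsub>model.M\<^esub> j = \<one>\<^bsub>model.M\<^esub>"
        by (simp only: \<phi>.hom_mult \<phi>.hom_int_pow rel.a_closed rel.b_closed rel.int_pow_closed \<phi>)
    qed
  qed blast
  then show ?thesis
    by (simp only: G_def a_def b_def)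
qed

text \<open>By \<open>swap\<close> the generators in exchanged order again satisfy the relations,
  which yields an endomorphism exchanging them. Its square fixes the generators and is therefore the
  identity.\<close>

lemma G2_swap_automorphism:
  assumes e: "e \<ge> 2" and kl: "k \<in> {0, 1}" "l \<in> {0, 1}" "e = 2 \<Longrightarrow> k = 0 \<and> l = 0"
  shows "\<exists>\<phi> \<in> carrier (AutoGroup (G2 e k l)). group.ord (AutoGroup (G2 e k l)) \<phi> = 2 \<and>
    \<phi> (G2_a e k l) = G2_b e k l \<and> \<phi> (G2_b e k l) = G2_a e k l"
proof -
  define G where "G = G2 e k l"
  define a where "a = G2_a e k l"
  define b where "b = G2_b e k l"
  have group: "group G" and c: "a \<in> carrier G" "b \<in> carrier G"
    by (simp_all add: G_def a_def b_def group_G2 G2_gens_closed)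
  interpret G2_group G "2 ^ (e - 2)" "int k" "int l" a b
    "a [^]\<^bsub>G\<^esub> (2 * 2 ^ (e - 2) :: int) \<otimes>\<^bsub>G\<^esub> b [^]\<^bsub>G\<^esub> (2 * 2 ^ (e - 2) :: int)"
    using G2_group_G2[OF assms] by (simp only: G_def a_def b_def)
  have "satisfies_G2_rels G e k l b a"
    using satisfies_G2_rels_iff[OF group e kl c(2,1)] swap G2_relations.z_def[OF swap] by simp
  then obtain \<phi> where hom: "\<phi> \<in> hom G G" and \<phi>: "\<phi> a = b" "\<phi> b = a"
    using G2_universal[OF group c(2,1)] by (metis G_def a_def b_def)
  have closed: "\<phi> x \<in> carrier G" if "x \<in> carrier G" for x
    using hom that by (rule hom_in_carrier)
  have inv: "\<phi> (\<phi> x) = x" if "x \<in> carrier G" for x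
  proof -
    have homs: "\<phi> \<circ> \<phi> \<in> hom G G" "id \<in> hom G G"
      using hom by (auto simp: hom_def Pi_iff)
    have eq: "(\<phi> \<circ> \<phi>) y = id y" if "y \<in> {a, b}" for y
      using that \<phi> by fastforce
    have "(\<phi> \<circ> \<phi>) x = id x"
      by (rule hom_eq_on_generate[OF group group homs _ eq, of "{a, b}"]) (use that gen in simp_all)
    then show ?thesis
      by simp
  qed
  \<comment> \<open>Members of \<open>AutoGroup\<close> must be extensional on the carrier, hence
    the restriction.\<close>
  define \<psi> where "\<psi> = restrict \<phi> (carrier G)"
  have "bij_betw \<psi> (carrier G) (carrier G)"
    by (rule bij_betwI[where g = \<phi>]) (auto simp: \<psi>_def closed inv)
  then have Bij: "\<psi> \<in> Bij (carrier G)"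
    by (simp add: Bij_def \<psi>_def)
  moreover have "\<psi> \<in> hom G G"
    using hom by (auto simp: hom_def \<psi>_def)
  ultimately have auto: "\<psi> \<in> carrier (AutoGroup G)"
    by (simp add: AutoGroup_def auto_def)
  interpret A: group "AutoGroup G"
    by (rule AutoGroup)
  have "compose (carrier G) \<psi> \<psi> = (\<lambda>x \<in> carrier G. x)"
    by (rule ext) (simp add: compose_def \<psi>_def closed inv)
  then have "\<psi> \<otimes>\<^bsub>AutoGroup G\<^esub> \<psi> = \<one>\<^bsub>AutoGroup G\<^esub>"
    using Bij by (simp add: AutoGroup_def BijGroup_def)
  then have "\<psi> [^]\<^bsub>AutoGroup G\<^esub> (2::int) = \<one>\<^bsub>AutoGroup G\<^esub>"
    using A.int_pow_mult[OF auto, of 1 1] auto by simp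
  moreover have "\<psi> \<noteq> \<one>\<^bsub>AutoGroup G\<^esub>"
  proof
    assume "\<psi> = \<one>\<^bsub>AutoGroup G\<^esub>"
    then have "\<psi> a = a"
      by (simp add: AutoGroup_def BijGroup_def)
    then have "b = a"
      by (simp add: \<psi>_def \<phi>)
    then have "nf 0 1 = nf 1 0"
      unfolding nf_def by simp
    then have "4 * 2 ^ (e - 2) = (1::int)"
      by (simp add: nf_eq_iff)
    then show False
      by presburger
  qed
  ultimately have "A.ord \<psi> = 2"
    using A.ord_eq_2I auto by blast
  then show ?thesis
    using auto \<phi> unfolding G_def[symmetric] a_def[symmetric] b_def[symmetric]
    by (intro bexI[of _ \<psi>]) (simp_all add: \<psi>_def)
qed

theorem lemma2p1:
  fixes e k l n m :: nat
    and G :: "gen2 word set monoid" (structure)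
    and a b z :: "gen2 word set"
  assumes n: "n = 2 ^ e" "n \<ge> 4"
    and m: "m = n div 2"
    and kl: "k \<in> {0, 1}" "l \<in> {0, 1}" "e = 2 \<Longrightarrow> k = 0 \<and> l = 0"
    and G: "G = G2 e k l"
    and a: "a = G2_a e k l"
    and b: "b = G2_b e k l"
    and z: "z = a [^] m \<otimes> b [^] m"
  shows
    \<comment> \<open>(i)\<close>
    "(\<forall>x \<in> {a [^] m, b [^] m, z}. x \<in> group_center G \<and> group.ord G x = 2)
    \<and>
    \<comment> \<open>(ii)\<close>
    (\<forall>i j :: int.
       (even i \<and> even j \<longrightarrow> b [^] j \<otimes> a [^] i = a [^] i \<otimes> b [^] j) \<and>
       (odd i \<and> even j \<longrightarrow>
          b [^] j \<otimes> a [^] i = a [^] i \<otimes> b [^] (- j) \<otimes> z [^] (int l * j div 2)) \<and>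
       (even i \<and> odd j \<longrightarrow>
          b [^] j \<otimes> a [^] i = a [^] (- i) \<otimes> b [^] j \<otimes> z [^] (int l * i div 2)) \<and>
       (odd i \<and> odd j \<longrightarrow>
          b [^] j \<otimes> a [^] i =
            a [^] (- i) \<otimes> b [^] (- j) \<otimes> z [^] (int k + int l * (i + j) div 2)))
    \<and>
    \<comment> \<open>(iii)\<close>
    (\<forall>(i :: int) (j :: int) g. g = a [^] i \<otimes> b [^] j \<longrightarrow>
       (even i \<and> even j \<longrightarrow> group.ord G g dvd m) \<and>
       (odd i \<and> even j \<longrightarrow> group.ord G g = n \<and> g [^] m = a [^] m) \<and>
       (even i \<and> odd j \<longrightarrow> group.ord G g = n \<and> g [^] m = b [^] m) \<and>
       (odd i \<and> odd j \<longrightarrow>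
          group.ord G g dvd 4 \<and> (k = 0 \<and> l = 0 \<longrightarrow> group.ord G g = 2)))
    \<and>
    \<comment> \<open>(iv)\<close>
    isobicyclic G (2 ^ e) a b
    \<and>
    \<comment> \<open>(v)\<close>
    (let u = a [^] (2::int) \<otimes> b [^] (-2::int) \<otimes> z [^] k; v = a [^] (4::int) \<otimes> z [^] l
     in internal_direct_product G (derived G (carrier G)) (generate G {u}) (generate G {v}) \<and>
        subgroup_generated G {u} \<cong> integer_mod_group m \<and>
        subgroup_generated G {v} \<cong> integer_mod_group (m div 2))
    \<and>
    \<comment> \<open>(vi)\<close>
    \<not> metacyclic G
    \<and>
    \<comment> \<open>(vii)\<close>
    has_nilpotence_class G e \<and>
    upper_central G 0 = {\<one>} \<and> upper_central G e = carrier G \<and>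
    (\<forall>i<e. upper_central G i \<subset> upper_central G (Suc i)) \<and>
    (\<forall>i\<le>e. upper_central G i =
       generate G {a [^] (2 ^ (e - i) :: nat)} <#> generate G {b [^] (2 ^ (e - i) :: nat)})"
proof -
  have e: "e \<ge> 2"
  proof (rule ccontr)
    assume "\<not> e \<ge> 2"
    then have "e = 0 \<or> e = 1"
      by auto
    then show False
      using n by auto
  qed
  define h :: int where "h = 2 ^ (e - 2)"
  obtain d where d: "e = d + 2"
    using e by (metis le_add_diff_inverse2)
  have h: "4 * h = 2 ^ e" "4 * h = int n" "2 * h = int m" "h = int (m div 2)"
    by (simp_all add: h_def n(1) m d)
  have m_pow: "x [^] m = x [^] (2 * h)" "x [^] k = x [^] int k" "x [^] l = x [^] int l" for x
    using h(3) int_pow_int[of G x m] int_pow_int[of G x k] int_pow_int[of G x l] by simp_all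
  have z_eq: "z = a [^] (2 * h) \<otimes> b [^] (2 * h)"
    by (simp only: z m_pow)
  interpret G2_group G h "int k" "int l" a b z
    using G2_group_G2[OF e kl] by (simp only: z_eq G a b h_def)
  have nats: "nat (4 * h) = n" "nat (2 * h) = m" "nat h = m div 2"
    using h(2-4) by simp_all
  have m_pos: "m > 0" "m div 2 > 0"
    using h_pos h(3,4) by linarith+
  \<comment> \<open>In the statement \<open>int l * j div 2\<close> parses as a division of the
    product, whereas \<open>twist\<close> multiplies after dividing; the two agree on even
    numbers.\<close>
  have swap_div: "int l * j div 2 = int l * (j div 2)" if "even j" for j
    using that by (rule div_mult_swap[symmetric])
  show ?thesis
  proof (intro conjI)
    show "\<forall>x \<in> {a [^] m, b [^] m, z}. x \<in> group_center G \<and> ord x = 2"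
      unfolding m_pow using central_involutions by blast
    show "\<forall>i j :: int.
       (even i \<and> even j \<longrightarrow> b [^] j \<otimes> a [^] i = a [^] i \<otimes> b [^] j) \<and>
       (odd i \<and> even j \<longrightarrow>
          b [^] j \<otimes> a [^] i = a [^] i \<otimes> b [^] (- j) \<otimes> z [^] (int l * j div 2)) \<and>
       (even i \<and> odd j \<longrightarrow>
          b [^] j \<otimes> a [^] i = a [^] (- i) \<otimes> b [^] j \<otimes> z [^] (int l * i div 2)) \<and>
       (odd i \<and> odd j \<longrightarrow>
          b [^] j \<otimes> a [^] i =
            a [^] (- i) \<otimes> b [^] (- j) \<otimes> z [^] (int k + int l * (i + j) div 2))"
      by (simp add: b_pow_a_pow twist_def swap_div)
    show "\<forall>(i :: int) (j :: int) g. g = a [^] i \<otimes> b [^] j \<longrightarrow>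
       (even i \<and> even j \<longrightarrow> ord g dvd m) \<and>
       (odd i \<and> even j \<longrightarrow> ord g = n \<and> g [^] m = a [^] m) \<and>
       (even i \<and> odd j \<longrightarrow> ord g = n \<and> g [^] m = b [^] m) \<and>
       (odd i \<and> odd j \<longrightarrow> ord g dvd 4 \<and> (k = 0 \<and> l = 0 \<longrightarrow> ord g = 2))"
      unfolding m_pow nf_def[symmetric]
      using ord_nf_even ord_nf ord_nf_odd nf_pow_half by (simp add: nats)
    show "isobicyclic G (2 ^ e) a b"
      unfolding isobicyclic_def n(1)[symmetric]
      by (intro conjI a_closed b_closed factorization(1,4) G2_swap_automorphism[OF e kl, folded G a b])
        (simp_all only: factorization nats)
    show "let u = a [^] (2::int) \<otimes> b [^] (-2::int) \<otimes> z [^] k; v = a [^] (4::int) \<otimes> z [^] l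
     in internal_direct_product G (derived G (carrier G)) (generate G {u}) (generate G {v}) \<and>
        subgroup_generated G {u} \<cong> integer_mod_group m \<and>
        subgroup_generated G {v} \<cong> integer_mod_group (m div 2)"
      unfolding Let_def m_pow u_def[symmetric] v_def[symmetric]
      using derived_direct_product iso_integer_mod_group[OF u_closed ord_u]
        iso_integer_mod_group[OF v_closed ord_v] m_pos by (simp add: nats)
    show "\<not> metacyclic G"
      by (rule not_metacyclic)
    show "has_nilpotence_class G e"
      by (rule nilpotence_class[OF h(1)])
    show "upper_central G 0 = {\<one>}"
      by simp
    show "upper_central G e = carrier G"
      by (rule upper_central_top[OF h(1)])
    show "\<forall>i<e. upper_central G i \<subset> upper_central G (Suc i)"
      using upper_central_strict[OF h(1)] by blast
    show "\<forall>i\<le>e. upper_central G i =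
       generate G {a [^] (2 ^ (e - i) :: nat)} <#> generate G {b [^] (2 ^ (e - i) :: nat)}"
      by (simp add: generate_a_generate_b_powers upper_central_eq[OF h(1)])
  qed
qed

end
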